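(* There is an algorithm that, given a real $r>0$, the length $|\mathcal{C}|\le nr$ of a closed cycle $\mathcal{C}$, and a set of $n$ points $p_1,\dots,p_n$ on $\mathcal{C}$ given in clockwise order by their coordinates $0=x_1<x_2<\dots<x_n<|\mathcal{C}|$, finds a lexicographically optimal solution to the connectivity maintenance on a closed cycle problem in $O(n)$ time.
   Context: Setting. $\mathcal{C}$ is a closed cycle of length $|\mathcal{C}|>0$. The coordinate of a location on $\mathcal{C}$ is its clockwise distance from the initial position of $p_1$, taken in $[0,|\mathcal{C}|)$. Points move only along $\mathcal{C}$. The connectivity maintenance on a closed cycle problem. Points keep their cyclic order. A solution is a vector of signed displacements $(\delta_1,\dots,\delta_n)\in\mathbb{R}^n$ (positive means clockwise, negative means counterclockwise) such that, with $y_i=x_i+\delta_i$ (positions on the unrolled cycle), one has $0\le y_{i+1}-y_i\le r$ for $1\le i<n$ and $0\le y_1+|\mathcal{C}|-y_n\le r$. Thus every adjacent pair of points, including $p_n,p_1$, is at distance at most $r$ going around the cycle. The moving distance of $p_i$ is $|\delta_i|$, and the objective is to minimize the maximum moving distance. Lexicographic optimality. A solution is lexicographically optimal if the vector of its moving distances $|\delta_1|,\dots,|\delta_n|$, sorted in non-increasing order, is lexicographically smallest among the sorted vectors of all solutions. (In particular it minimizes the maximum moving distance.) Model of computation: arithmetic operations and comparisons on real numbers each take constant time. *)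

theory Defs
  imports Complex_Main "HOL-Library.Landau_Symbols"
begin

section \<open>Connectivity maintenance on a closed cycle\<close>

text \<open>
  Points are indexed by \<open>1, \<dots>, n\<close>; values of \<open>x\<close> and \<open>\<delta>\<close> at other indices are irrelevant.
  \<open>L\<close> is the length of the cycle.
\<close>

definition cycle_instance :: "nat \<Rightarrow> real \<Rightarrow> real \<Rightarrow> (nat \<Rightarrow> real) \<Rightarrow> bool" where
  "cycle_instance n r L x \<longleftrightarrow>
     1 \<le> n \<and> 0 < r \<and> 0 < L \<and> L \<le> real n * r \<and>
     x 1 = 0 \<and> (\<forall>i. 1 \<le> i \<and> i < n \<longrightarrow> x i < x (i + 1)) \<and> x n < L"

definition is_solution ::
    "nat \<Rightarrow> real \<Rightarrow> real \<Rightarrow> (nat \<Rightarrow> real) \<Rightarrow> (nat \<Rightarrow> real) \<Rightarrow> bool" where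
  "is_solution n r L x \<delta> \<longleftrightarrow>
     (let y = (\<lambda>i. x i + \<delta> i) in
       (\<forall>i. 1 \<le> i \<and> i < n \<longrightarrow> 0 \<le> y (i + 1) - y i \<and> y (i + 1) - y i \<le> r) \<and>
       0 \<le> y 1 + L - y n \<and> y 1 + L - y n \<le> r)"

definition sorted_distances :: "nat \<Rightarrow> (nat \<Rightarrow> real) \<Rightarrow> real list" where
  "sorted_distances n \<delta> = rev (sort (map (\<lambda>i. \<bar>\<delta> i\<bar>) [1..<n+1]))"

definition lex_optimal ::
    "nat \<Rightarrow> real \<Rightarrow> real \<Rightarrow> (nat \<Rightarrow> real) \<Rightarrow> (nat \<Rightarrow> real) \<Rightarrow> bool" where
  "lex_optimal n r L x \<delta> \<longleftrightarrow>
     is_solution n r L x \<delta> \<and>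
     (\<forall>\<delta>'. is_solution n r L x \<delta>' \<longrightarrow>
        sorted_distances n \<delta> = sorted_distances n \<delta>' \<or>
        (sorted_distances n \<delta>, sorted_distances n \<delta>') \<in> lexord {(a, b). a < b})"

section \<open>A real random access machine\<close>

text \<open>
  Programs are finite syntactic objects working on named arrays, one family holding natural
  numbers (used for indices) and one holding real numbers; cell 0 of an array serves as a scalar
  variable. Index arithmetic is limited to addition and truncated subtraction. There is no
  conversion between the two kinds of values, in particular no rounding of reals, and all
  constants are integers. Division by zero yields 0.
\<close>

type_synonym name = string

record state =
  imem :: "name \<Rightarrow> nat \<Rightarrow> nat"
  rmem :: "name \<Rightarrow> nat \<Rightarrow> real"

datatype iexp =
    INum nat
  | IGet name iexp
  | IAdd iexp iexp
  | ISub iexp iexp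

datatype rexp =
    RNum int
  | RGet name iexp
  | RAdd rexp rexp
  | RSub rexp rexp
  | RMul rexp rexp
  | RDiv rexp rexp

datatype bexp =
    ILess iexp iexp
  | RLess rexp rexp
  | BNot bexp
  | BAnd bexp bexp

datatype com =
    Skip
  | ISet name iexp iexp
  | RSet name iexp rexp
  | Seq com com
  | Cond bexp com com
  | While bexp com

primrec ival :: "iexp \<Rightarrow> state \<Rightarrow> nat" where
  "ival (INum k) s = k"
| "ival (IGet a e) s = imem s a (ival e s)"
| "ival (IAdd e f) s = ival e s + ival f s"
| "ival (ISub e f) s = ival e s - ival f s"

primrec rval :: "rexp \<Rightarrow> state \<Rightarrow> real" where
  "rval (RNum k) s = of_int k"
| "rval (RGet a e) s = rmem s a (ival e s)"
| "rval (RAdd e f) s = rval e s + rval f s"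
| "rval (RSub e f) s = rval e s - rval f s"
| "rval (RMul e f) s = rval e s * rval f s"
| "rval (RDiv e f) s = rval e s / rval f s"

primrec bval :: "bexp \<Rightarrow> state \<Rightarrow> bool" where
  "bval (ILess e f) s = (ival e s < ival f s)"
| "bval (RLess e f) s = (rval e s < rval f s)"
| "bval (BNot b) s = (\<not> bval b s)"
| "bval (BAnd b c) s = (bval b s \<and> bval c s)"

text \<open>Every constant, memory access, arithmetic operation, comparison and connective costs 1.\<close>

primrec icost :: "iexp \<Rightarrow> nat" where
  "icost (INum k) = 1"
| "icost (IGet a e) = 1 + icost e"
| "icost (IAdd e f) = 1 + icost e + icost f"
| "icost (ISub e f) = 1 + icost e + icost f"

primrec rcost :: "rexp \<Rightarrow> nat" where
  "rcost (RNum k) = 1"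
| "rcost (RGet a e) = 1 + icost e"
| "rcost (RAdd e f) = 1 + rcost e + rcost f"
| "rcost (RSub e f) = 1 + rcost e + rcost f"
| "rcost (RMul e f) = 1 + rcost e + rcost f"
| "rcost (RDiv e f) = 1 + rcost e + rcost f"

primrec bcost :: "bexp \<Rightarrow> nat" where
  "bcost (ILess e f) = 1 + icost e + icost f"
| "bcost (RLess e f) = 1 + rcost e + rcost f"
| "bcost (BNot b) = 1 + bcost b"
| "bcost (BAnd b c) = 1 + bcost b + bcost c"

text \<open>\<open>exec c s t s'\<close>: started in \<open>s\<close>, the program \<open>c\<close> halts in \<open>s'\<close> after \<open>t\<close> elementary steps.\<close>

inductive exec :: "com \<Rightarrow> state \<Rightarrow> nat \<Rightarrow> state \<Rightarrow> bool" where
  Skip: "exec Skip s 1 s"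
| ISet: "exec (ISet a i e) s (1 + icost i + icost e)
     (s\<lparr>imem := (imem s)(a := (imem s a)(ival i s := ival e s))\<rparr>)"
| RSet: "exec (RSet a i e) s (1 + icost i + rcost e)
     (s\<lparr>rmem := (rmem s)(a := (rmem s a)(ival i s := rval e s))\<rparr>)"
| Seq: "exec c s t s' \<Longrightarrow> exec d s' u s'' \<Longrightarrow> exec (Seq c d) s (t + u) s''"
| CondTrue: "bval b s \<Longrightarrow> exec c s t s' \<Longrightarrow> exec (Cond b c d) s (1 + bcost b + t) s'"
| CondFalse: "\<not> bval b s \<Longrightarrow> exec d s t s' \<Longrightarrow> exec (Cond b c d) s (1 + bcost b + t) s'"
| WhileFalse: "\<not> bval b s \<Longrightarrow> exec (While b c) s (1 + bcost b) s"
| WhileTrue: "bval b s \<Longrightarrow> exec c s t s' \<Longrightarrow> exec (While b c) s' u s'' \<Longrightarrow>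
     exec (While b c) s (1 + bcost b + t + u) s''"

inductive_cases exec_elims:
  "exec Skip s t s'" "exec (ISet a i e) s t s'" "exec (RSet a i e) s t s'"
  "exec (Seq c d) s t s'" "exec (Cond b c d) s t s'"
inductive_cases exec_While_elim: "exec (While b c) s t s'"

text \<open>Execution is deterministic, so the existence of a halting run says that the run halts.\<close>

lemma exec_deterministic:
  "exec c s t s' \<Longrightarrow> exec c s u s'' \<Longrightarrow> u = t \<and> s'' = s'"
proof (induction arbitrary: u s'' rule: exec.induct)
  case (WhileFalse b s c)
  then show ?case by (auto elim: exec_While_elim)
next
  case (WhileTrue b s c t s' v s1)
  from WhileTrue.prems WhileTrue.hyps(1) obtain t2 s2 v2
    where "exec c s t2 s2" "exec (While b c) s2 v2 s''" "u = 1 + bcost b + t2 + v2"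
    by (auto elim: exec_While_elim)
  then show ?case using WhileTrue.IH by blast
qed (erule exec_elims; fastforce)+

text \<open>
  Memory outside the input cells is arbitrary, so a program may not rely on it being cleared.
\<close>

definition holds_input :: "nat \<Rightarrow> real \<Rightarrow> real \<Rightarrow> (nat \<Rightarrow> real) \<Rightarrow> state \<Rightarrow> bool" where
  "holds_input n r L x s \<longleftrightarrow>
     imem s ''n'' 0 = n \<and> rmem s ''r'' 0 = r \<and> rmem s ''L'' 0 = L \<and>
     (\<forall>i\<in>{1..n}. rmem s ''x'' i = x i)"

end

theory Submission imports Defs "HOL-Library.Multiset" begin

text \<open>
  With \<open>z i = y i - i r\<close> the constraints say that \<open>z\<close> is nonincreasing with steps of at most \<open>r\<close>
  and drops by \<open>c = n r - L\<close> per period. So \<open>z\<close> is a cyclic isotonic approximation of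
  \<open>w i = x i - i r\<close>, and pooling adjacent violators, with the midrange as the value of a block,
  is lexicographically optimal: within a block every point that is moved up (down) has a point
  to its right (left) that is moved down (up) at least as far, so any change hurts one of the two.
  The cyclic case needs no second pass: after the linear phase only the seam can be violated,
  and then the first block, shifted by one period, is merged into the last one.
\<close>

section \<open>Lexicographic comparison\<close>

text \<open>The midrange depends only on the two extremes of a block, so a merge costs constant
  time. Optimality is not tracked along the run: the final levels together with their witnesses form
  a certificate that alone yields feasibility and optimality. Absorbing the shifted first block
  moves the place where the cycle is cut; hence the statements refer to a window of \<open>n\<close>
  unrolled indices that starts at some \<open>a\<close> between 1 and \<open>n\<close> and lies
  within two unrolled periods. A merge at the seam changes the last level and removes the first
  block, so afterwards only the top pair and the seam need to be checked again. The bound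
  \<open>L \<le> n r\<close>, that is \<open>c \<ge> 0\<close>, enters when pooling ends with a
  single block: both ends of the window then share one level and the seam condition is exactly
  \<open>c \<ge> 0\<close>.\<close>

lemma lexord_of_count:
  fixes xs ys :: "real list"
  assumes "sorted_wrt (\<ge>) xs" "sorted_wrt (\<ge>) ys"
    and "\<And>u. t < u \<Longrightarrow> count (mset xs) u = count (mset ys) u"
    and "count (mset xs) t < count (mset ys) t"
  shows "(xs, ys) \<in> lexord {(a, b). a < b}"
  using assms
proof (induction xs arbitrary: ys)
  case Nil
  then show ?case by (cases ys) auto
next
  case (Cons x xs)
  then obtain y ys' where ys: "ys = y # ys'" by (cases ys) auto
  have "t \<in> set ys"
    using Cons.prems(4) by (metis count_inI less_nat_zero_code set_mset_mset)
  then have ty: "t \<le> y" using Cons.prems(2) ys by auto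
  \<comment> \<open>Otherwise \<open>x\<close> exceeds \<open>y\<close> and hence \<open>t\<close>,
    so the counts of \<open>x\<close> agree, although \<open>x\<close> is above every entry of
    \<open>ys\<close>.\<close>
  have "\<not> y < x"
  proof
    assume "y < x"
    then have "count (mset ys) x = count (mset (x # xs)) x"
      using Cons.prems(3)[of x] ty by (metis less_le_trans not_le order_less_le_trans)
    then have "x \<in># mset ys" by (intro count_inI) simp
    then have "x \<in> set ys" by simp
    then show False using Cons.prems(2) ys \<open>y < x\<close> by auto
  qed
  then consider "x < y" | "x = y" by linarith
  then show ?case
  proof cases
    case 1
    then show ?thesis using ys by simp
  next
    case 2
    have "(xs, ys') \<in> lexord {(a, b). a < b}"
    proof (rule Cons.IH)
      show "count (mset xs) u = count (mset ys') u" if "t < u" for u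
        using Cons.prems(3)[OF that] ys 2 by (auto split: if_splits)
      show "count (mset xs) t < count (mset ys') t"
        using Cons.prems(4) ys 2 by (auto split: if_splits)
    qed (use Cons.prems ys in auto)
    then show ?thesis using ys 2 by simp
  qed
qed

text \<open>The largest value whose multiplicity differs decides the comparison of non-increasing
  lists. Here it is the largest distance of \<open>\<delta>'\<close> on \<open>S\<close>: all
  distances of \<open>\<delta>\<close> on \<open>S\<close> stay below it and nothing changes
  outside, so higher values keep their multiplicity and this one loses a copy.\<close>

lemma sorted_distances_lexord:
  assumes S: "S \<subseteq> {1..n}" "i \<in> S"
    and out: "\<And>j. j \<in> {1..n} - S \<Longrightarrow> \<bar>\<delta> j\<bar> = \<bar>\<delta>' j\<bar>"
    and less: "\<And>j. j \<in> S \<Longrightarrow> \<bar>\<delta> j\<bar> < \<bar>\<delta>' i\<bar>"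
  shows "(sorted_distances n \<delta>, sorted_distances n \<delta>') \<in> lexord {(a, b). a < b}"
proof -
  define t where "t = Max ((\<lambda>j. \<bar>\<delta>' j\<bar>) ` S)"
  have fin: "finite S" using S finite_subset by blast
  have le_t: "\<bar>\<delta>' j\<bar> \<le> t" if "j \<in> S" for j
    unfolding t_def using that fin by simp
  have "t \<in> (\<lambda>j. \<bar>\<delta>' j\<bar>) ` S"
    unfolding t_def using fin S by (intro Max_in) auto
  then obtain m where m: "m \<in> S" "\<bar>\<delta>' m\<bar> = t" by auto
  have less_t: "\<bar>\<delta> j\<bar> < t" if "j \<in> S" for j
    using less[OF that] le_t[OF S(2)] by linarith
  have cnt: "count (mset (sorted_distances n \<epsilon>)) u = card {j \<in> {1..n}. \<bar>\<epsilon> j\<bar> = u}" for \<epsilon> u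
  proof -
    have "count (mset (sorted_distances n \<epsilon>)) u = length (filter (\<lambda>j. u = \<bar>\<epsilon> j\<bar>) [1..<n+1])"
      by (simp add: sorted_distances_def count_mset count_list_eq_length_filter filter_map o_def
          del: upt_Suc mset_map)
    also have "\<dots> = card (set (filter (\<lambda>j. u = \<bar>\<epsilon> j\<bar>) [1..<n+1]))"
      by (simp add: distinct_card del: upt_Suc set_filter)
    also have "set (filter (\<lambda>j. u = \<bar>\<epsilon> j\<bar>) [1..<n+1]) = {j \<in> {1..n}. \<bar>\<epsilon> j\<bar> = u}"
      by (auto simp del: upt_Suc)
    finally show ?thesis .
  qed
  have desc: "sorted_wrt (\<ge>) (sorted_distances n \<epsilon>)" for \<epsilon>
    by (simp add: sorted_distances_def sorted_wrt_rev del: upt_Suc)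
  show ?thesis
  proof (rule lexord_of_count[OF desc desc, of t])
    fix u assume "t < u"
    then have "{j \<in> {1..n}. \<bar>\<delta> j\<bar> = u} = {j \<in> {1..n}. \<bar>\<delta>' j\<bar> = u}"
      using out less_t le_t by (metis (no_types, lifting) DiffI leD less_asym)
    then show "count (mset (sorted_distances n \<delta>)) u = count (mset (sorted_distances n \<delta>')) u"
      by (simp only: cnt)
  next
    have "{j \<in> {1..n}. \<bar>\<delta> j\<bar> = t} \<subset> {j \<in> {1..n}. \<bar>\<delta>' j\<bar> = t}"
    proof
      show "{j \<in> {1..n}. \<bar>\<delta> j\<bar> = t} \<subseteq> {j \<in> {1..n}. \<bar>\<delta>' j\<bar> = t}"
        using out less_t by fastforce
      show "{j \<in> {1..n}. \<bar>\<delta> j\<bar> = t} \<noteq> {j \<in> {1..n}. \<bar>\<delta>' j\<bar> = t}"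
      proof -
        have "m \<in> {j \<in> {1..n}. \<bar>\<delta>' j\<bar> = t}" using m S(1) by auto
        moreover have "m \<notin> {j \<in> {1..n}. \<bar>\<delta> j\<bar> = t}" using less_t[OF m(1)] by auto
        ultimately show ?thesis by blast
      qed
    qed
    then show "count (mset (sorted_distances n \<delta>)) t < count (mset (sorted_distances n \<delta>')) t"
      unfolding cnt by (intro psubset_card_mono) auto
  qed
qed

section \<open>A certificate of lexicographic optimality\<close>

definition wrap :: "nat \<Rightarrow> nat \<Rightarrow> nat" where
  "wrap n j = (if j \<le> n then j else j - n)"

definition unrolled :: "nat \<Rightarrow> real \<Rightarrow> real \<Rightarrow> (nat \<Rightarrow> real) \<Rightarrow> nat \<Rightarrow> real" where
  "unrolled n r L x j = (if j \<le> n then x j else x (j - n) + L) - real j * r"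

definition moved :: "nat \<Rightarrow> real \<Rightarrow> real \<Rightarrow> (nat \<Rightarrow> real) \<Rightarrow> (nat \<Rightarrow> real) \<Rightarrow> nat \<Rightarrow> real" where
  "moved n r L x \<delta> j = unrolled n r L x j + \<delta> (wrap n j)"

lemma unrolled_shift:
  assumes "1 \<le> j" "j \<le> n"
  shows "unrolled n r L x (j + n) = unrolled n r L x j - (real n * r - L)"
  using assms by (auto simp: unrolled_def algebra_simps)

lemma moved_shift:
  assumes "1 \<le> j" "j \<le> n"
  shows "moved n r L x \<delta> (j + n) = moved n r L x \<delta> j - (real n * r - L)"
  using assms by (auto simp: moved_def unrolled_shift wrap_def)

text \<open>The step at \<open>n\<close> crosses the seam, and the step at \<open>j + n\<close>
  repeats the one at \<open>j\<close> because both of its ends shift by the same constant. So any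
  \<open>n\<close> consecutive steps contain every constraint once, wherever the cycle is
  cut.\<close>

lemma is_solution_iff_moved:
  assumes "1 \<le> a" "a \<le> n"
  shows "is_solution n r L x \<delta> \<longleftrightarrow>
    (\<forall>j\<in>{a..<a+n}. 0 \<le> moved n r L x \<delta> j - moved n r L x \<delta> (j + 1) \<and>
        moved n r L x \<delta> j - moved n r L x \<delta> (j + 1) \<le> r)"
    (is "_ \<longleftrightarrow> (\<forall>j\<in>_. ?step j)")
proof -
  \<comment> \<open>A drop of \<open>moved\<close> is \<open>r\<close> minus the gap of the two
    points, so the bounds 0 and \<open>r\<close> exchange their roles.\<close>
  have inner: "?step j \<longleftrightarrow>
      0 \<le> x (j + 1) + \<delta> (j + 1) - (x j + \<delta> j) \<and> x (j + 1) + \<delta> (j + 1) - (x j + \<delta> j) \<le> r"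
    if "1 \<le> j" "j < n" for j
    using that by (auto simp: moved_def unrolled_def wrap_def algebra_simps)
  have seam: "?step n \<longleftrightarrow>
      0 \<le> x 1 + \<delta> 1 + L - (x n + \<delta> n) \<and> x 1 + \<delta> 1 + L - (x n + \<delta> n) \<le> r"
    using assms by (auto simp: moved_def unrolled_def wrap_def algebra_simps)
  have shift: "?step (j + n) \<longleftrightarrow> ?step j" if "1 \<le> j" "j < n" for j
    using that moved_shift[of j n r L x \<delta>] moved_shift[of "j + 1" n r L x \<delta>]
    by (simp add: add.commute add.left_commute)
  have "is_solution n r L x \<delta> \<longleftrightarrow> (\<forall>j. 1 \<le> j \<and> j < n \<longrightarrow> ?step j) \<and> ?step n"
    unfolding is_solution_def Let_def using inner seam by blast
  also have "\<dots> \<longleftrightarrow> (\<forall>j\<in>{a..<a+n}. ?step j)" (is "?lhs \<longleftrightarrow> ?rhs")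
  proof
    assume h: ?lhs
    show ?rhs
    proof
      fix j assume j: "j \<in> {a..<a+n}"
      consider "j < n" | "j = n" | "n < j" by linarith
      then show "?step j"
      proof cases
        case 1
        then show ?thesis using h j assms by auto
      next
        case 2
        then show ?thesis using h by blast
      next
        case 3
        then have "j = (j - n) + n" "1 \<le> j - n" "j - n < n" using j assms by auto
        then show ?thesis using h shift by metis
      qed
    qed
  next
    assume h: ?rhs
    have "?step j" if j: "1 \<le> j \<and> j < n" for j
    proof (cases "a \<le> j")
      case True
      then show ?thesis using h j by auto
    next
      case False
      then have "j + n \<in> {a..<a+n}" using j assms by auto
      then have "?step (j + n)" by (rule bspec[OF h])
      then show ?thesis using shift[of j] j by blast
    qed
    moreover have "?step n" using h assms by auto
    ultimately show ?lhs by blast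
  qed
  finally show ?thesis .
qed

text \<open>The sums encode the witnesses: \<open>W i + W j \<le> 2 * Z i\<close> means that
  \<open>j\<close> is moved up by at least \<open>W i - Z i\<close>, the amount by which
  \<open>i\<close> is moved down. The choice \<open>j = i\<close> is open only to points that do not
  move.\<close>

definition certified :: "nat \<Rightarrow> real \<Rightarrow> (nat \<Rightarrow> real) \<Rightarrow> nat \<Rightarrow> (nat \<Rightarrow> real) \<Rightarrow> bool" where
  "certified n c W a Z \<longleftrightarrow>
     (\<forall>i j. a \<le> i \<and> i \<le> j \<and> j < a + n \<longrightarrow> Z j \<le> Z i) \<and>
     Z a - c \<le> Z (a + n - 1) \<and>
     (\<forall>i\<in>{a..<a+n}. Z i \<le> W i \<longrightarrow> (\<exists>j\<in>{a..i}. Z j = Z i \<and> W i + W j \<le> 2 * Z i)) \<and>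
     (\<forall>i\<in>{a..<a+n}. W i \<le> Z i \<longrightarrow> (\<exists>j\<in>{i..<a+n}. Z j = Z i \<and> 2 * Z i \<le> W i + W j))"

text \<open>
  The constraint that points keep their order comes for free: where two neighbours lie on
  different levels, the first is not moved up and the second is not moved down.
\<close>

lemma certified_is_solution:
  assumes inst: "cycle_instance n r L x" and a: "1 \<le> a" "a \<le> n"
    and cert: "certified n (real n * r - L) (unrolled n r L x) a (moved n r L x \<delta>)"
  shows "is_solution n r L x \<delta>"
  unfolding is_solution_iff_moved[OF a]
proof
  fix j assume j: "j \<in> {a..<a+n}"
  let ?W = "unrolled n r L x" and ?Z = "moved n r L x \<delta>" and ?c = "real n * r - L"
  have mono: "\<And>i j. a \<le> i \<Longrightarrow> i \<le> j \<Longrightarrow> j < a + n \<Longrightarrow> ?Z j \<le> ?Z i"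
    and seam: "?Z a - ?c \<le> ?Z (a + n - 1)"
    and low: "\<And>i. i \<in> {a..<a+n} \<Longrightarrow> ?Z i \<le> ?W i \<Longrightarrow>
        \<exists>j\<in>{a..i}. ?Z j = ?Z i \<and> ?W i + ?W j \<le> 2 * ?Z i"
    and high: "\<And>i. i \<in> {a..<a+n} \<Longrightarrow> ?W i \<le> ?Z i \<Longrightarrow>
        \<exists>j\<in>{i..<a+n}. ?Z j = ?Z i \<and> 2 * ?Z i \<le> ?W i + ?W j"
    using cert unfolding certified_def by auto
  have x: "0 < r" "\<And>i. 1 \<le> i \<Longrightarrow> i < n \<Longrightarrow> x i < x (i + 1)" "x 1 = 0" "x n < L"
    using inst unfolding cycle_instance_def by auto
  \<comment> \<open>The input positions increase strictly, also across the seam. A drop of the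
    levels by more than \<open>r\<close> therefore exceeds the drop of the data.\<close>
  have Wstep: "?W j - ?W (j + 1) < r"
  proof -
    consider "j < n" | "j = n" | "n < j" by linarith
    then show ?thesis
    proof cases
      case 1
      then show ?thesis using x(2)[of j] j a by (simp add: unrolled_def algebra_simps)
    next
      case 2
      then show ?thesis using x(3,4) by (simp add: unrolled_def algebra_simps)
    next
      case 3
      then have "x (j - n) < x (j - n + 1)" using j a by (intro x(2)) auto
      moreover have "j + 1 - n = j - n + 1" using 3 by simp
      ultimately show ?thesis using 3 by (simp add: unrolled_def algebra_simps)
    qed
  qed
  show "0 \<le> ?Z j - ?Z (j + 1) \<and> ?Z j - ?Z (j + 1) \<le> r"
  proof (cases "j + 1 = a + n")
    case True
    have Z: "?Z (j + 1) = ?Z a - ?c" and W: "?W (j + 1) = ?W a - ?c"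
      using True moved_shift[OF a] unrolled_shift[OF a] by simp_all
    have "?Z j - ?Z (j + 1) \<le> r"
    proof (rule ccontr)
      assume far: "\<not> ?thesis"
      \<comment> \<open>The window ends at \<open>j\<close>, so the only possible witness of
        \<open>j\<close> is \<open>j\<close> itself; likewise for \<open>a\<close> at the other
        end.\<close>
      have "?Z j \<le> ?W j"
      proof (rule ccontr)
        assume "\<not> ?Z j \<le> ?W j"
        then obtain i where "i \<in> {j..<a+n}" "2 * ?Z j \<le> ?W j + ?W i" using high[OF j] by auto
        moreover from this have "i = j" using True by simp
        ultimately show False using \<open>\<not> ?Z j \<le> ?W j\<close> by simp
      qed
      moreover have "?W a \<le> ?Z a"
      proof (rule ccontr)
        assume "\<not> ?W a \<le> ?Z a"
        then obtain i where "i \<in> {a..a}" "?W a + ?W i \<le> 2 * ?Z a" using low[of a] a by force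
        then show False using \<open>\<not> ?W a \<le> ?Z a\<close> by simp
      qed
      ultimately show False using far Wstep Z W by linarith
    qed
    moreover have "j = a + n - 1" using True by simp
    ultimately show ?thesis using seam Z by simp
  next
    case False
    then have j': "j + 1 \<in> {a..<a+n}" "j + 1 < a + n" using j by auto
    have le: "?Z (j + 1) \<le> ?Z j" using mono[of j "j + 1"] j j' by simp
    moreover have "?Z j - ?Z (j + 1) \<le> r"
    proof (rule ccontr)
      assume far: "\<not> ?thesis"
      have "?Z j \<le> ?W j"
      proof (rule ccontr)
        assume "\<not> ?Z j \<le> ?W j"
        then obtain i where i: "i \<in> {j..<a+n}" "?Z i = ?Z j" "2 * ?Z j \<le> ?W j + ?W i"
          using high[OF j] by auto
        \<comment> \<open>A witness strictly to the right would lie at or below the level of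
          \<open>j + 1\<close>, more than \<open>r\<close> lower. So \<open>j\<close> could only be
          its own witness, which means that it is not moved up.\<close>
        have "i = j"
        proof (rule ccontr)
          assume "i \<noteq> j"
          then have "?Z i \<le> ?Z (j + 1)" using i(1) j' by (intro mono) auto
          then show False using i far x(1) by linarith
        qed
        then show False using \<open>\<not> ?Z j \<le> ?W j\<close> i by simp
      qed
      moreover have "?W (j + 1) \<le> ?Z (j + 1)"
      proof (rule ccontr)
        assume neg: "\<not> ?W (j + 1) \<le> ?Z (j + 1)"
        then obtain i where i: "i \<in> {a..j + 1}" "?Z i = ?Z (j + 1)"
            "?W (j + 1) + ?W i \<le> 2 * ?Z (j + 1)"
          using low[OF j'(1)] by auto
        have "i = j + 1"
        proof (rule ccontr)
          assume "i \<noteq> j + 1"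
          then have "?Z j \<le> ?Z i" using i(1) j by (intro mono) auto
          then show False using i far x(1) by linarith
        qed
        then show False using neg i by simp
      qed
      ultimately show False using far Wstep by linarith
    qed
    ultimately show ?thesis by simp
  qed
qed

text \<open>
  Among the places where a competitor differs, take one with the largest distance \<open>D\<close>. If the
  competitor moves that point less, it moves the witness on the same level by more than \<open>D\<close>.
\<close>

lemma certified_lex_optimal:
  assumes inst: "cycle_instance n r L x" and a: "1 \<le> a" "a \<le> n"
    and cert: "certified n (real n * r - L) (unrolled n r L x) a (moved n r L x \<delta>)"
  shows "lex_optimal n r L x \<delta>"
  unfolding lex_optimal_def
proof (intro conjI allI impI)
  show "is_solution n r L x \<delta>" by (rule certified_is_solution[OF assms])
  fix \<delta>' assume sol: "is_solution n r L x \<delta>'"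
  let ?W = "unrolled n r L x" and ?Z = "moved n r L x \<delta>" and ?Y = "moved n r L x \<delta>'"
  have mono: "\<And>i j. a \<le> i \<Longrightarrow> i \<le> j \<Longrightarrow> j < a + n \<Longrightarrow> ?Z j \<le> ?Z i"
    and low: "\<And>i. i \<in> {a..<a+n} \<Longrightarrow> ?Z i \<le> ?W i \<Longrightarrow>
        \<exists>j\<in>{a..i}. ?Z j = ?Z i \<and> ?W i + ?W j \<le> 2 * ?Z i"
    and high: "\<And>i. i \<in> {a..<a+n} \<Longrightarrow> ?W i \<le> ?Z i \<Longrightarrow>
        \<exists>j\<in>{i..<a+n}. ?Z j = ?Z i \<and> 2 * ?Z i \<le> ?W i + ?W j"
    using cert unfolding certified_def by auto
  have monoY: "?Y j \<le> ?Y i" if "a \<le> i" "i \<le> j" "j < a + n" for i j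
    using that(2,3)
  proof (induction j rule: dec_induct)
    case (step m)
    have "?Y (m + 1) \<le> ?Y m"
      using sol step that(1) unfolding is_solution_iff_moved[OF a] by force
    then show ?case using step by simp
  qed simp
  have \<delta>: "\<delta> (wrap n j) = ?Z j - ?W j" and \<delta>': "\<delta>' (wrap n j) = ?Y j - ?W j" for j
    by (simp_all add: moved_def)
  have wrap_onto: "\<exists>j\<in>{a..<a+n}. wrap n j = i" if "i \<in> {1..n}" for i
  proof (cases "a \<le> i")
    case True
    then show ?thesis using that a by (intro bexI[of _ i]) (auto simp: wrap_def)
  next
    case False
    then show ?thesis using that a by (intro bexI[of _ "i + n"]) (auto simp: wrap_def)
  qed
  have wrap_in: "wrap n j \<in> {1..n}" if "j \<in> {a..<a+n}" for j
    using that a by (auto simp: wrap_def)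
  define S where "S = {j \<in> {a..<a+n}. ?Y j \<noteq> ?Z j}"
  show "sorted_distances n \<delta> = sorted_distances n \<delta>' \<or>
      (sorted_distances n \<delta>, sorted_distances n \<delta>') \<in> lexord {(a, b). a < b}"
  proof (cases "S = {}")
    case True
    have "\<delta> i = \<delta>' i" if "i \<in> {1..n}" for i
    proof -
      obtain j where j: "j \<in> {a..<a+n}" "wrap n j = i" using wrap_onto \<open>i \<in> {1..n}\<close> by blast
      then have "?Y j = ?Z j" using True S_def by blast
      then show ?thesis using \<delta>[of j] \<delta>'[of j] j by simp
    qed
    then have "sorted_distances n \<delta> = sorted_distances n \<delta>'"
      unfolding sorted_distances_def
      by (intro arg_cong[where f = "\<lambda>l. rev (sort l)"] map_cong) auto
    then show ?thesis ..
  next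
    case False
    have "finite S" unfolding S_def by simp
    then have "Max ((\<lambda>j. \<bar>?Z j - ?W j\<bar>) ` S) \<in> (\<lambda>j. \<bar>?Z j - ?W j\<bar>) ` S"
      using False by (intro Max_in) auto
    then obtain i where i: "i \<in> S" "Max ((\<lambda>j. \<bar>?Z j - ?W j\<bar>) ` S) = \<bar>?Z i - ?W i\<bar>" by auto
    have max: "\<bar>?Z j - ?W j\<bar> \<le> \<bar>?Z i - ?W i\<bar>" if "j \<in> S" for j
      using i(2) Max_ge[of "(\<lambda>j. \<bar>?Z j - ?W j\<bar>) ` S" "\<bar>?Z j - ?W j\<bar>"] \<open>finite S\<close> that by auto
    have iw: "i \<in> {a..<a+n}" "?Y i \<noteq> ?Z i" using i S_def by auto
    have "\<exists>j\<in>S. \<bar>?Z i - ?W i\<bar> < \<bar>?Y j - ?W j\<bar>"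
    proof (cases "?Z i < ?Y i")
      case up: True
      show ?thesis
      proof (cases "?Z i \<le> ?W i")
        \<comment> \<open>The competitor moves \<open>i\<close> down less. As \<open>?Y\<close> is
          nonincreasing, it lifts the witness \<open>j\<close> to the left above the common level as
          well, and \<open>j\<close> was already moved up by at least \<open>D\<close>.\<close>
        case True
        then obtain j where j: "j \<in> {a..i}" "?Z j = ?Z i" "?W i + ?W j \<le> 2 * ?Z i"
          using low[OF iw(1)] by auto
        have "?Y i \<le> ?Y j" using j iw by (intro monoY) auto
        then have "j \<in> S" "\<bar>?Z i - ?W i\<bar> < \<bar>?Y j - ?W j\<bar>"
          using up j iw True unfolding S_def by auto
        then show ?thesis by blast
      next
        case False
        then show ?thesis using up i by (intro bexI[of _ i]) auto
      qed
    next
      case False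
      then have down: "?Y i < ?Z i" using iw by simp
      show ?thesis
      proof (cases "?W i \<le> ?Z i")
        case True
        then obtain j where j: "j \<in> {i..<a+n}" "?Z j = ?Z i" "2 * ?Z i \<le> ?W i + ?W j"
          using high[OF iw(1)] by auto
        have "?Y j \<le> ?Y i" using j iw by (intro monoY) auto
        then have "j \<in> S" "\<bar>?Z i - ?W i\<bar> < \<bar>?Y j - ?W j\<bar>"
          using down j iw True unfolding S_def by auto
        then show ?thesis by blast
      next
        case False
        then show ?thesis using down i by (intro bexI[of _ i]) auto
      qed
    qed
    then obtain m where m: "m \<in> S" "\<bar>?Z i - ?W i\<bar> < \<bar>?Y m - ?W m\<bar>" by blast
    \<comment> \<open>On \<open>S\<close> every distance of \<open>\<delta>\<close> is at most
      \<open>D\<close>, and \<open>m\<close> gives the competitor a distance above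
      \<open>D\<close>.\<close>
    have "(sorted_distances n \<delta>, sorted_distances n \<delta>') \<in> lexord {(a, b). a < b}"
    proof (rule sorted_distances_lexord[where S = "wrap n ` S" and i = "wrap n m"])
      show "wrap n ` S \<subseteq> {1..n}" using wrap_in S_def by auto
      show "wrap n m \<in> wrap n ` S" using m by simp
      show "\<bar>\<delta> j\<bar> = \<bar>\<delta>' j\<bar>" if j: "j \<in> {1..n} - wrap n ` S" for j
      proof -
        obtain k where k: "k \<in> {a..<a+n}" "wrap n k = j" using wrap_onto j by blast
        then have "?Y k = ?Z k" using j S_def by blast
        then show ?thesis using \<delta>[of k] \<delta>'[of k] k by simp
      qed
      show "\<bar>\<delta> j\<bar> < \<bar>\<delta>' (wrap n m)\<bar>" if "j \<in> wrap n ` S" for j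
        using that max m \<delta> \<delta>' by fastforce
    qed
    then show ?thesis ..
  qed
qed

section \<open>Pooling adjacent violators\<close>

text \<open>The last two clauses are the witness conditions of \<open>certified\<close> for the
  constant level \<open>(M + m) / 2\<close>, doubled to avoid division and confined to the block, so
  that a witness automatically lies on the same level.\<close>

definition block :: "(nat \<Rightarrow> real) \<Rightarrow> nat \<Rightarrow> nat \<Rightarrow> real \<Rightarrow> real \<Rightarrow> bool" where
  "block W a b M m \<longleftrightarrow>
     (\<forall>i\<in>{a..<b}. m \<le> W i \<and> W i \<le> M) \<and>
     (\<exists>i\<in>{a..<b}. W i = M) \<and> (\<exists>i\<in>{a..<b}. W i = m) \<and>
     (\<forall>i\<in>{a..<b}. M + m \<le> 2 * W i \<longrightarrow> (\<exists>j\<in>{a..i}. W i + W j \<le> M + m)) \<and>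
     (\<forall>i\<in>{a..<b}. 2 * W i \<le> M + m \<longrightarrow> (\<exists>j\<in>{i..<b}. M + m \<le> W i + W j))"

lemma block_nonempty: "block W a b M m \<Longrightarrow> a < b"
  unfolding block_def by auto

lemma block_low:
  "block W a b M m \<Longrightarrow> a \<le> i \<Longrightarrow> i < b \<Longrightarrow> M + m \<le> 2 * W i \<Longrightarrow> \<exists>j\<in>{a..i}. W i + W j \<le> M + m"
  unfolding block_def by simp

lemma block_high:
  "block W a b M m \<Longrightarrow> a \<le> i \<Longrightarrow> i < b \<Longrightarrow> 2 * W i \<le> M + m \<Longrightarrow> \<exists>j\<in>{i..<b}. M + m \<le> W i + W j"
  unfolding block_def by simp

lemma block_single: "block W a (Suc a) (W a) (W a)"
  unfolding block_def by auto

text \<open>The data and both extremes drop by \<open>c\<close>, so both sides of every witness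
  inequality drop by \<open>2 * c\<close>.\<close>

lemma block_shift:
  assumes "block W a b M m" and "\<And>j. a \<le> j \<Longrightarrow> j < b \<Longrightarrow> W (j + n) = W j - c"
  shows "block W (a + n) (b + n) (M - c) (m - c)"
proof -
  have img: "{a + n..<b + n} = (\<lambda>j. j + n) ` {a..<b}" by simp
  have low: "\<exists>j\<in>{a + n..i + n}. W (i + n) + W j \<le> M - c + (m - c)"
    if i: "i \<in> {a..<b}" "M - c + (m - c) \<le> 2 * W (i + n)" for i
  proof -
    have "M + m \<le> 2 * W i" using i assms(2)[of i] by auto
    then obtain j where "j \<in> {a..i}" "W i + W j \<le> M + m" using assms(1) i(1) unfolding block_def by blast
    then show ?thesis using i assms(2)[of i] assms(2)[of j] by (intro bexI[of _ "j + n"]) auto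
  qed
  have high: "\<exists>j\<in>{i + n..<b + n}. M - c + (m - c) \<le> W (i + n) + W j"
    if i: "i \<in> {a..<b}" "2 * W (i + n) \<le> M - c + (m - c)" for i
  proof -
    have "2 * W i \<le> M + m" using i assms(2)[of i] by auto
    then obtain j where "j \<in> {i..<b}" "M + m \<le> W i + W j" using assms(1) i(1) unfolding block_def by blast
    then show ?thesis using i assms(2)[of i] assms(2)[of j] by (intro bexI[of _ "j + n"]) auto
  qed
  have "\<forall>i\<in>{a..<b}. m - c \<le> W (i + n) \<and> W (i + n) \<le> M - c"
       "\<exists>i\<in>{a..<b}. W (i + n) = M - c" "\<exists>i\<in>{a..<b}. W (i + n) = m - c"
    using assms unfolding block_def by force+
  then show ?thesis
    unfolding block_def img ball_simps bex_simps using low high by (simp add: image_iff)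
qed

text \<open>
  The new midrange lies between the old ones. If the maximum of the union is not attained in
  the right part, then the midrange of the left part is unchanged.
\<close>

lemma block_merge:
  assumes A: "block W a b M m" and B: "block W b d M' m'" and le: "M + m \<le> M' + m'"
  shows "block W a d (max M M') (min m m')"
proof -
  let ?V = "max M M' + min m m'"
  have ab: "a < b" "b < d" using A B block_nonempty by auto
  have between: "M + m \<le> ?V" "?V \<le> M' + m'" using le by (auto simp: max_def min_def)
  have bdA: "m \<le> W i" "W i \<le> M" if "i \<in> {a..<b}" for i using A that unfolding block_def by auto
  have bdB: "m' \<le> W i" "W i \<le> M'" if "i \<in> {b..<d}" for i using B that unfolding block_def by auto
  have split: "i \<in> {a..<b} \<or> i \<in> {b..<d}" if "i \<in> {a..<d}" for i using that by auto
  have bd: "min m m' \<le> W i \<and> W i \<le> max M M'" if "i \<in> {a..<d}" for i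
    using split[OF that] bdA bdB by (meson max.coboundedI1 max.coboundedI2 min.coboundedI1 min.coboundedI2)
  obtain i1 i2 i3 i4 where ex: "i1 \<in> {a..<b}" "W i1 = M" "i2 \<in> {a..<b}" "W i2 = m"
      "i3 \<in> {b..<d}" "W i3 = M'" "i4 \<in> {b..<d}" "W i4 = m'"
    using A B unfolding block_def by meson
  have "\<exists>i\<in>{a..<d}. W i = max M M'"
    using ex ab by (cases "M \<le> M'") (auto intro: bexI[of _ i3] bexI[of _ i1])
  moreover have "\<exists>i\<in>{a..<d}. W i = min m m'"
    using ex ab by (cases "m \<le> m'") (auto intro: bexI[of _ i4] bexI[of _ i2])
  moreover have "\<exists>j\<in>{a..i}. W i + W j \<le> ?V" if i: "i \<in> {a..<d}" "?V \<le> 2 * W i" for i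
  proof (cases "i < b")
    \<comment> \<open>The new midrange is not below the left one, so the old witness in the left
      part still serves.\<close>
    case True
    then obtain j where "j \<in> {a..i}" "W i + W j \<le> M + m"
      using A i between unfolding block_def by (metis atLeastLessThan_iff order_trans)
    then show ?thesis using between by force
  next
    case False
    show ?thesis
    \<comment> \<open>The witness is sought at the overall minimum. If it is attained on the left,
      it precedes \<open>i\<close>. If not, \<open>m' < m\<close> together with \<open>le\<close>
      forces \<open>M < M'\<close>, and the right part keeps its midrange and its witnesses.\<close>
    proof (cases "m \<le> m'")
      case True
      then show ?thesis using ex False bd[OF i(1)] by (intro bexI[of _ i2]) auto
    next
      case F: False
      have V: "?V = M' + m'" using F le by (auto simp: max_def min_def)
      then obtain j where "j \<in> {b..i}" "W i + W j \<le> M' + m'"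
        using B i False unfolding block_def by (metis atLeastLessThan_iff not_less)
      then show ?thesis using V ab by (intro bexI[of _ j]) auto
    qed
  qed
  moreover have "\<exists>j\<in>{i..<d}. ?V \<le> W i + W j" if i: "i \<in> {a..<d}" "2 * W i \<le> ?V" for i
  proof (cases "b \<le> i")
    case True
    then obtain j where "j \<in> {i..<d}" "M' + m' \<le> W i + W j"
      using B i between unfolding block_def by (metis atLeastLessThan_iff order_trans)
    then show ?thesis using between by force
  next
    case False
    show ?thesis
    proof (cases "M \<le> M'")
      case True
      then show ?thesis using ex False bd[OF i(1)] by (intro bexI[of _ i3]) auto
    next
      case F: False
      have V: "?V = M + m" using F le by (auto simp: max_def min_def)
      then obtain j where "j \<in> {i..<b}" "M + m \<le> W i + W j"
        using A i False unfolding block_def by (metis atLeastLessThan_iff not_less)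
      then show ?thesis using V ab by (intro bexI[of _ j]) auto
    qed
  qed
  ultimately show ?thesis unfolding block_def using bd by blast
qed

section \<open>Stacks of blocks: the states of the pooling procedure\<close>

text \<open>
  The blocks are \<open>{st p..<st (p + 1)}\<close> for \<open>f \<le> p \<le> k\<close>; together they cover a window of at most
  one period. Only the last two blocks may violate monotonicity.
\<close>

definition block_stack ::
    "nat \<Rightarrow> (nat \<Rightarrow> real) \<Rightarrow> nat \<Rightarrow> nat \<Rightarrow> (nat \<Rightarrow> nat) \<Rightarrow> (nat \<Rightarrow> real) \<Rightarrow> (nat \<Rightarrow> real) \<Rightarrow> bool" where
  "block_stack n W f k st mx mn \<longleftrightarrow>
     f \<le> k + 1 \<and> 1 \<le> st f \<and> st (k + 1) \<le> st f + n \<and> (st (k + 1) < st f + n \<longrightarrow> st f = 1) \<and>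
     (\<forall>p\<in>{f..k}. st p \<le> n \<and> block W (st p) (st (p + 1)) (mx p) (mn p)) \<and>
     (\<forall>p. f \<le> p \<longrightarrow> p + 1 < k \<longrightarrow> mx (p + 1) + mn (p + 1) \<le> mx p + mn p)"

text \<open>A push turns the old top pair, so far exempt from monotonicity, into an ordinary pair;
  \<open>ord\<close> supplies its inequality. The new singleton is a block because its point does
  not move.\<close>

lemma block_stack_push:
  assumes inv: "block_stack n W f k st mx mn" and room: "st (k + 1) < st f + n"
    and ord: "f < k \<Longrightarrow> mx k + mn k \<le> mx (k - 1) + mn (k - 1)"
  shows "block_stack n W f (k + 1) (st(k + 2 := st (k + 1) + 1))
    (mx(k + 1 := W (st (k + 1)))) (mn(k + 1 := W (st (k + 1))))"
proof -
  have "mx (p + 1) + mn (p + 1) \<le> mx p + mn p" if "f \<le> p" "p < k" for p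
    using that ord inv unfolding block_stack_def
    by (cases "p + 1 = k") (auto simp: less_Suc_eq)
  then show ?thesis
    using inv room block_single[of W "st (k + 1)"] unfolding block_stack_def by auto
qed

text \<open>The merged block becomes the new top at \<open>k - 1\<close>, so its changed level
  occurs only in the exempt pair. Cell \<open>st k\<close> now has to hold the end of the
  stack.\<close>

lemma block_stack_merge:
  assumes inv: "block_stack n W f k st mx mn" and fk: "f < k"
    and viol: "mx (k - 1) + mn (k - 1) \<le> mx k + mn k"
  shows "block_stack n W f (k - 1) (st(k := st (k + 1)))
    (mx(k - 1 := max (mx (k - 1)) (mx k))) (mn(k - 1 := min (mn (k - 1)) (mn k)))"
proof -
  obtain l where k: "k = l + 1" "f \<le> l" using fk by (metis add.commute less_iff_Suc_add le_add1 plus_1_eq_Suc)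
  have "block W (st l) (st (l + 1)) (mx l) (mn l)"
      "block W (st (l + 1)) (st (l + 2)) (mx (l + 1)) (mn (l + 1))"
    using inv k unfolding block_stack_def by auto
  then have "block W (st l) (st (l + 2)) (max (mx l) (mx (l + 1))) (min (mn l) (mn (l + 1)))"
    using viol k by (intro block_merge) auto
  then show ?thesis using inv k unfolding block_stack_def by auto
qed

text \<open>In a full window the first block, shifted by \<open>n\<close>, starts exactly where the
  last one ends. Both ends of the window advance by the same amount, so it stays full, and
  \<open>f < k\<close> keeps its start within the first period.\<close>

lemma block_stack_wrap:
  assumes inv: "block_stack n W f k st mx mn" and fk: "f < k" and full: "st (k + 1) = st f + n"
    and viol: "mx k + mn k \<le> mx f + mn f - 2 * c"
    and per: "\<And>j. 1 \<le> j \<Longrightarrow> j \<le> n \<Longrightarrow> W (j + n) = W j - c"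
  shows "block_stack n W (f + 1) k (st(k + 1 := st (f + 1) + n))
    (mx(k := max (mx k) (mx f - c))) (mn(k := min (mn k) (mn f - c)))"
proof -
  have f: "block W (st f) (st (f + 1)) (mx f) (mn f)" "1 \<le> st f" "st (f + 1) \<le> n"
    and top: "block W (st k) (st (k + 1)) (mx k) (mn k)"
    using inv fk unfolding block_stack_def by auto
  have "block W (st (k + 1)) (st (f + 1) + n) (mx f - c) (mn f - c)"
    unfolding full using f by (intro block_shift[OF f(1)] per) auto
  then have "block W (st k) (st (f + 1) + n) (max (mx k) (mx f - c)) (min (mn k) (mn f - c))"
    using viol by (intro block_merge[OF top]) auto
  then show ?thesis
    using inv fk block_nonempty[OF f(1)] unfolding block_stack_def by auto
qed

lemma block_stack_certified:
  assumes inv: "block_stack n W f k st mx mn" and n: "1 \<le> n" and c: "0 \<le> c"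
    and full: "st (k + 1) = st f + n"
    and ord: "f < k \<Longrightarrow> mx k + mn k \<le> mx (k - 1) + mn (k - 1)"
    and seam: "f < k \<Longrightarrow> mx f + mn f - 2 * c \<le> mx k + mn k"
    and Z: "\<And>q. q \<in> {st f..<st f + n} \<Longrightarrow>
        \<exists>p\<in>{f..k}. st p \<le> q \<and> q < st (p + 1) \<and> Z q = (mx p + mn p) / 2"
  shows "certified n c W (st f) Z"
proof -
  have fk: "f \<le> k" using inv full n unfolding block_stack_def by (metis Suc_eq_plus1 add_cancel_right_right le_SucE not_one_le_zero)
  have blk: "block W (st p) (st (p + 1)) (mx p) (mn p)" if "p \<in> {f..k}" for p
    using inv that unfolding block_stack_def by auto
  have st_mono: "st p \<le> st p'" if "f \<le> p" "p \<le> p'" "p' \<le> k + 1" for p p'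
    using that(2,3)
  proof (induction p' rule: dec_induct)
    case (step m)
    then show ?case using block_nonempty[OF blk[of m]] that(1) by simp
  qed simp
  have V_mono: "mx p' + mn p' \<le> mx p + mn p" if "f \<le> p" "p \<le> p'" "p' \<le> k" for p p'
    using that(2,3)
  proof (induction p' rule: dec_induct)
    case (step m)
    have "mx (m + 1) + mn (m + 1) \<le> mx m + mn m"
    proof (cases "m + 1 = k")
      case True
      then show ?thesis using ord step that(1) by auto
    next
      case False
      then show ?thesis using inv step that(1) unfolding block_stack_def by auto
    qed
    then show ?case using step by simp
  qed simp
  \<comment> \<open>\<open>Z\<close> only promises some block around \<open>q\<close>; the blocks
    are disjoint, so it is \<open>p\<close>.\<close>
  have same: "Z q = (mx p + mn p) / 2" if "p \<in> {f..k}" "st p \<le> q" "q < st (p + 1)" for p q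
  proof -
    have "st f \<le> q" "q < st f + n"
      using that st_mono[of f p] st_mono[of "p + 1" "k + 1"] full by auto
    then obtain p' where p': "p' \<in> {f..k}" "st p' \<le> q" "q < st (p' + 1)" "Z q = (mx p' + mn p') / 2"
      using Z by force
    have "\<not> p < p'" "\<not> p' < p"
      using that p' st_mono[of "p + 1" p'] st_mono[of "p' + 1" p] by auto
    then show ?thesis using p' by (metis linorder_neqE_nat)
  qed
  have st_f: "st f < st (f + 1)" "st k < st (k + 1)"
    using block_nonempty[OF blk[of f]] block_nonempty[OF blk[of k]] fk by auto
  show ?thesis
    unfolding certified_def
  proof (intro conjI allI impI ballI)
    fix i j assume ij: "st f \<le> i \<and> i \<le> j \<and> j < st f + n"
    obtain p where p: "p \<in> {f..k}" "st p \<le> i" "i < st (p + 1)" "Z i = (mx p + mn p) / 2"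
      using Z[of i] ij by auto
    obtain p' where p': "p' \<in> {f..k}" "st p' \<le> j" "j < st (p' + 1)" "Z j = (mx p' + mn p') / 2"
      using Z[of j] ij by auto
    have "p \<le> p'" using p p' ij st_mono[of "p' + 1" p] by force
    then show "Z j \<le> Z i" using V_mono[of p p'] p p' by auto
  next
    have "Z (st f) = (mx f + mn f) / 2" using st_f fk by (intro same) auto
    moreover have "Z (st f + n - 1) = (mx k + mn k) / 2"
      using st_f fk full by (intro same) auto
    \<comment> \<open>For a single block both ends have the same level, and what remains is
      \<open>c \<ge> 0\<close>.\<close>
    ultimately show "Z (st f) - c \<le> Z (st f + n - 1)"
      using seam fk c by (cases "f = k") auto
  next
    fix i assume i: "i \<in> {st f..<st f + n}" "Z i \<le> W i"
    obtain p where p: "p \<in> {f..k}" "st p \<le> i" "i < st (p + 1)" "Z i = (mx p + mn p) / 2"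
      using Z[of i] i by auto
    have "mx p + mn p \<le> 2 * W i" using p(4) i(2) by simp
    then obtain j where j: "j \<in> {st p..i}" "W i + W j \<le> mx p + mn p"
      using block_low[OF blk[OF p(1)] p(2,3)] by blast
    then have "Z j = Z i" using p same[of p j] by auto
    moreover have "st f \<le> st p" using p st_mono by auto
    ultimately show "\<exists>j\<in>{st f..i}. Z j = Z i \<and> W i + W j \<le> 2 * Z i"
      using j p by (intro bexI[of _ j]) auto
  next
    fix i assume i: "i \<in> {st f..<st f + n}" "W i \<le> Z i"
    obtain p where p: "p \<in> {f..k}" "st p \<le> i" "i < st (p + 1)" "Z i = (mx p + mn p) / 2"
      using Z[of i] i by auto
    have "2 * W i \<le> mx p + mn p" using p(4) i(2) by simp
    then obtain j where j: "j \<in> {i..<st (p + 1)}" "mx p + mn p \<le> W i + W j"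
      using block_high[OF blk[OF p(1)] p(2,3)] by blast
    then have "Z j = Z i" using p same[of p j] by auto
    moreover have "st (p + 1) \<le> st f + n" using p st_mono[of "p + 1" "k + 1"] full by auto
    ultimately show "\<exists>j\<in>{i..<st f + n}. Z j = Z i \<and> 2 * Z i \<le> W i + W j"
      using j p by (intro bexI[of _ j]) auto
  qed
qed

section \<open>Reasoning about programs\<close>

primrec loopfree :: "com \<Rightarrow> bool" where
  "loopfree Skip = True"
| "loopfree (ISet a i e) = True"
| "loopfree (RSet a i e) = True"
| "loopfree (Seq c d) = (loopfree c \<and> loopfree d)"
| "loopfree (Cond b c d) = (loopfree c \<and> loopfree d)"
| "loopfree (While b c) = False"

text \<open>On loop-free code execution is a total function, which lets the simplifier execute loop
  bodies symbolically. The clause for \<open>While\<close> is a dummy, excluded by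
  \<open>loopfree\<close>.\<close>

primrec run :: "com \<Rightarrow> state \<Rightarrow> state" where
  "run Skip s = s"
| "run (ISet a i e) s = s\<lparr>imem := (imem s)(a := (imem s a)(ival i s := ival e s))\<rparr>"
| "run (RSet a i e) s = s\<lparr>rmem := (rmem s)(a := (rmem s a)(ival i s := rval e s))\<rparr>"
| "run (Seq c d) s = run d (run c s)"
| "run (Cond b c d) s = (if bval b s then run c s else run d s)"
| "run (While b c) s = s"

text \<open>A conditional is charged for both branches, so the bound does not depend on the
  state.\<close>

primrec ccost :: "com \<Rightarrow> nat" where
  "ccost Skip = 1"
| "ccost (ISet a i e) = 1 + icost i + icost e"
| "ccost (RSet a i e) = 1 + icost i + rcost e"
| "ccost (Seq c d) = ccost c + ccost d"
| "ccost (Cond b c d) = 1 + bcost b + ccost c + ccost d"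
| "ccost (While b c) = 0"

lemma exec_run:
  "loopfree c \<Longrightarrow> \<exists>t\<le>ccost c. exec c s t (run c s)"
proof (induction c arbitrary: s)
  case (Seq c d)
  then obtain t u where "t \<le> ccost c" "exec c s t (run c s)"
      "u \<le> ccost d" "exec d (run c s) u (run d (run c s))" by fastforce
  then show ?case by (auto intro!: exI[of _ "t + u"] exec.Seq)
next
  case (Cond b c d)
  show ?case
  proof (cases "bval b s")
    case True
    obtain t where "t \<le> ccost c" "exec c s t (run c s)" using Cond by fastforce
    then show ?thesis using True by (auto intro!: exI[of _ "1 + bcost b + t"] exec.CondTrue)
  next
    case False
    obtain t where "t \<le> ccost d" "exec d s t (run d s)" using Cond by fastforce
    then show ?thesis using False by (auto intro!: exI[of _ "1 + bcost b + t"] exec.CondFalse)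
  qed
next
  case Skip
  show ?case unfolding run.simps ccost.simps by (blast intro: exec.Skip)
next
  case (ISet a i e)
  show ?case unfolding run.simps ccost.simps by (blast intro: exec.ISet)
next
  case (RSet a i e)
  show ?case unfolding run.simps ccost.simps by (blast intro: exec.RSet)
qed simp

text \<open>There are at most \<open>\<mu> s\<close> iterations; the extra 1 pays for the final
  failing test.\<close>

lemma exec_while:
  assumes "loopfree c" and "I s"
    and step: "\<And>s. I s \<Longrightarrow> bval b s \<Longrightarrow> I (run c s) \<and> \<mu> (run c s) < \<mu> s"
  shows "\<exists>t s'. exec (While b c) s t s' \<and> t \<le> (\<mu> s + 1) * (1 + bcost b + ccost c) \<and>
    I s' \<and> \<not> bval b s'"
  using \<open>I s\<close>
proof (induction "\<mu> s" arbitrary: s rule: less_induct)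
  case less
  let ?K = "1 + bcost b + ccost c"
  show ?case
  proof (cases "bval b s")
    case True
    have dec: "I (run c s)" "\<mu> (run c s) < \<mu> s" using step less.prems True by auto
    obtain t where t: "t \<le> ccost c" "exec c s t (run c s)" using exec_run assms(1) by blast
    obtain u s' where u: "exec (While b c) (run c s) u s'" "u \<le> (\<mu> (run c s) + 1) * ?K"
        "I s'" "\<not> bval b s'"
      using less.hyps[OF dec(2,1)] by blast
    have "(\<mu> (run c s) + 1) * ?K \<le> \<mu> s * ?K" using dec(2) by (intro mult_right_mono) auto
    then have "1 + bcost b + t + u \<le> (\<mu> s + 1) * ?K" using t u by (simp add: algebra_simps)
    then show ?thesis using exec.WhileTrue[OF True t(2) u(1)] u by blast
  next
    case False
    then show ?thesis using exec.WhileFalse[OF False] less.prems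
      by (intro exI[of _ "1 + bcost b"] exI[of _ s]) auto
  qed
qed

text \<open>A Hoare triple for total correctness with a time bound; as execution is deterministic,
  some halting run means the run.\<close>

definition achieves :: "(state \<Rightarrow> bool) \<Rightarrow> com \<Rightarrow> nat \<Rightarrow> (state \<Rightarrow> bool) \<Rightarrow> bool" where
  "achieves P c T Q \<longleftrightarrow> (\<forall>s. P s \<longrightarrow> (\<exists>t s'. exec c s t s' \<and> t \<le> T \<and> Q s'))"

lemma achieves_Seq:
  "achieves P c T Q \<Longrightarrow> achieves Q d U R \<Longrightarrow> achieves P (Seq c d) (T + U) R"
  unfolding achieves_def by (meson add_mono exec.Seq)

lemma achieves_loopfree:
  "loopfree c \<Longrightarrow> (\<And>s. P s \<Longrightarrow> Q (run c s)) \<Longrightarrow> achieves P c (ccost c) Q"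
  unfolding achieves_def using exec_run by blast

lemma achieves_While:
  assumes "loopfree c"
    and "\<And>s. I s \<Longrightarrow> bval b s \<Longrightarrow> I (run c s) \<and> \<mu> (run c s) < \<mu> s"
    and "\<And>s. P s \<Longrightarrow> I s \<and> \<mu> s \<le> B"
    and "\<And>s. I s \<Longrightarrow> \<not> bval b s \<Longrightarrow> Q s"
  shows "achieves P (While b c) ((B + 1) * (1 + bcost b + ccost c)) Q"
  unfolding achieves_def
proof (intro allI impI)
  fix s assume "P s"
  then have I: "I s" and B: "\<mu> s \<le> B" using assms(3) by auto
  obtain t s' where e: "exec (While b c) s t s'" "t \<le> (\<mu> s + 1) * (1 + bcost b + ccost c)"
      "I s'" "\<not> bval b s'"
    using exec_while[where \<mu> = \<mu> and I = I, OF assms(1) I assms(2)] by blast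
  have "(\<mu> s + 1) * (1 + bcost b + ccost c) \<le> (B + 1) * (1 + bcost b + ccost c)"
    using B by (intro mult_right_mono) auto
  then show "\<exists>t s'. exec (While b c) s t s' \<and> t \<le> (B + 1) * (1 + bcost b + ccost c) \<and> Q s'"
    using e assms(4) order_trans by blast
qed

section \<open>The algorithm\<close>

abbreviation ivar :: "name \<Rightarrow> iexp" where "ivar a \<equiv> IGet a (INum 0)"
abbreviation rvar :: "name \<Rightarrow> rexp" where "rvar a \<equiv> RGet a (INum 0)"
abbreviation inext :: "iexp \<Rightarrow> iexp" where "inext e \<equiv> IAdd e (INum 1)"
abbreviation iprev :: "iexp \<Rightarrow> iexp" where "iprev e \<equiv> ISub e (INum 1)"

abbreviation twice_mid :: "iexp \<Rightarrow> rexp" where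
  "twice_mid e \<equiv> RAdd (RGet ''mx'' e) (RGet ''mn'' e)"

definition set_max :: "name \<Rightarrow> iexp \<Rightarrow> rexp \<Rightarrow> com" where
  "set_max a i e = Cond (RLess (RGet a i) e) (RSet a i e) Skip"

definition set_min :: "name \<Rightarrow> iexp \<Rightarrow> rexp \<Rightarrow> com" where
  "set_min a i e = Cond (RLess e (RGet a i)) (RSet a i e) Skip"

text \<open>As a simp rule this hides the conditional: symbolic execution yields the
  \<open>max\<close> update of the stack lemmas instead of a case split.\<close>

lemma run_set_max [simp]:
  "run (set_max a i e) s =
    s\<lparr>rmem := (rmem s)(a := (rmem s a)(ival i s := max (rmem s a (ival i s)) (rval e s)))\<rparr>"
  by (auto simp: set_max_def max_def)

lemma run_set_min [simp]:
  "run (set_min a i e) s =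
    s\<lparr>rmem := (rmem s)(a := (rmem s a)(ival i s := min (rmem s a (ival i s)) (rval e s)))\<rparr>"
  by (auto simp: set_min_def min_def)

lemma loopfree_set [simp]: "loopfree (set_max a i e)" "loopfree (set_min a i e)"
  by (simp_all add: set_max_def set_min_def)

text \<open>The machine cannot convert an index to a real, so the offset \<open>i * r\<close> is
  accumulated in \<open>''o''\<close> by repeated addition.\<close>

definition init_unroll :: com where
  "init_unroll = Seq (ISet ''i'' (INum 0) (INum 1)) (RSet ''o'' (INum 0) (RNum 0))"

definition unroll_test :: bexp where
  "unroll_test = ILess (ivar ''i'') (IAdd (inext (ivar ''n'')) (ivar ''n''))"

definition unroll_body :: com where
  "unroll_body =
    Seq (RSet ''o'' (INum 0) (RAdd (rvar ''o'') (rvar ''r'')))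
    (Seq (Cond (ILess (ivar ''n'') (ivar ''i''))
            (RSet ''w'' (ivar ''i'') (RSub (RAdd (RGet ''x'' (ISub (ivar ''i'') (ivar ''n''))) (rvar ''L'')) (rvar ''o'')))
            (RSet ''w'' (ivar ''i'') (RSub (RGet ''x'' (ivar ''i'')) (rvar ''o''))))
    (ISet ''i'' (INum 0) (inext (ivar ''i''))))"

text \<open>After the unrolling \<open>''o''\<close> holds \<open>2 * n * r\<close>, and half of it
  minus \<open>L\<close> is \<open>c\<close>. The values \<open>f = 1\<close> and
  \<open>k = 0\<close> encode the empty stack.\<close>

definition init_pool :: com where
  "init_pool =
    Seq (RSet ''c'' (INum 0) (RSub (RDiv (rvar ''o'') (RNum 2)) (rvar ''L'')))
    (Seq (ISet ''f'' (INum 0) (INum 1))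
    (Seq (ISet ''k'' (INum 0) (INum 0))
    (Seq (ISet ''st'' (INum 1) (INum 1))
    (ISet ''go'' (INum 0) (INum 1)))))"

definition merge_top :: com where
  "merge_top =
    Seq (set_max ''mx'' (iprev (ivar ''k'')) (RGet ''mx'' (ivar ''k'')))
    (Seq (set_min ''mn'' (iprev (ivar ''k'')) (RGet ''mn'' (ivar ''k'')))
    (Seq (ISet ''st'' (ivar ''k'') (IGet ''st'' (inext (ivar ''k''))))
    (ISet ''k'' (INum 0) (iprev (ivar ''k'')))))"

definition push_single :: com where
  "push_single =
    Seq (ISet ''k'' (INum 0) (inext (ivar ''k'')))
    (Seq (RSet ''mx'' (ivar ''k'') (RGet ''w'' (IGet ''st'' (ivar ''k''))))
    (Seq (RSet ''mn'' (ivar ''k'') (RGet ''w'' (IGet ''st'' (ivar ''k''))))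
    (ISet ''st'' (inext (ivar ''k'')) (inext (IGet ''st'' (ivar ''k''))))))"

text \<open>The order matters: the extremes are read at the old \<open>''f''\<close>, while the last
  assignment reads \<open>st\<close> at the new one, which is the new start of the window.\<close>

definition merge_seam :: com where
  "merge_seam =
    Seq (set_max ''mx'' (ivar ''k'') (RSub (RGet ''mx'' (ivar ''f'')) (rvar ''c'')))
    (Seq (set_min ''mn'' (ivar ''k'') (RSub (RGet ''mn'' (ivar ''f'')) (rvar ''c'')))
    (Seq (ISet ''f'' (INum 0) (inext (ivar ''f'')))
    (ISet ''st'' (inext (ivar ''k'')) (IAdd (IGet ''st'' (ivar ''f'')) (ivar ''n'')))))"

text \<open>One dispatching loop replaces nested loops, so the body is loop-free and a single
  measure bounds the time. A violated top pair is repaired before anything else, because a push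
  needs it ordered.\<close>

definition pool_body :: com where
  "pool_body =
    Cond (BAnd (ILess (ivar ''f'') (ivar ''k''))
               (RLess (twice_mid (iprev (ivar ''k''))) (twice_mid (ivar ''k''))))
      merge_top
      (Cond (ILess (IGet ''st'' (inext (ivar ''k''))) (IAdd (IGet ''st'' (ivar ''f'')) (ivar ''n'')))
        push_single
        (Cond (BAnd (ILess (ivar ''f'') (ivar ''k''))
                    (RLess (twice_mid (ivar ''k''))
                      (RSub (twice_mid (ivar ''f'')) (RMul (RNum 2) (rvar ''c'')))))
          merge_seam
          (ISet ''go'' (INum 0) (INum 0))))"

definition pool_test :: bexp where
  "pool_test = ILess (INum 0) (ivar ''go'')"

definition init_output :: com where
  "init_output =
    Seq (ISet ''p'' (INum 0) (ivar ''f''))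
    (ISet ''j'' (INum 0) (IGet ''st'' (ivar ''f'')))"

definition output_test :: bexp where
  "output_test = ILess (ivar ''j'') (IAdd (IGet ''st'' (ivar ''f'')) (ivar ''n''))"

text \<open>
  For \<open>j \<le> n\<close> the truncated subtraction sends the second write to the unused cell 0.
\<close>

definition output_body :: com where
  "output_body =
    Seq (RSet ''delta'' (ivar ''j'') (RSub (RDiv (twice_mid (ivar ''p'')) (RNum 2)) (RGet ''w'' (ivar ''j''))))
    (Seq (RSet ''delta'' (ISub (ivar ''j'') (ivar ''n'')) (RGet ''delta'' (ivar ''j'')))
    (Seq (ISet ''j'' (INum 0) (inext (ivar ''j'')))
    (Cond (ILess (ivar ''j'') (IGet ''st'' (inext (ivar ''p''))))
      Skip
      (ISet ''p'' (INum 0) (inext (ivar ''p''))))))"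

definition algorithm :: com where
  "algorithm =
    Seq (Seq init_unroll (While unroll_test unroll_body))
    (Seq (Seq init_pool (While pool_test pool_body))
    (Seq init_output (While output_test output_body)))"

section \<open>The unrolling loop\<close>

definition unroll_inv :: "nat \<Rightarrow> real \<Rightarrow> real \<Rightarrow> (nat \<Rightarrow> real) \<Rightarrow> state \<Rightarrow> bool" where
  "unroll_inv n r L x s \<longleftrightarrow> holds_input n r L x s \<and>
     1 \<le> imem s ''i'' 0 \<and> imem s ''i'' 0 \<le> 2 * n + 1 \<and>
     rmem s ''o'' 0 = (real (imem s ''i'' 0) - 1) * r \<and>
     (\<forall>j. 1 \<le> j \<longrightarrow> j < imem s ''i'' 0 \<longrightarrow> rmem s ''w'' j = unrolled n r L x j)"

definition unroll_post :: "nat \<Rightarrow> real \<Rightarrow> real \<Rightarrow> (nat \<Rightarrow> real) \<Rightarrow> state \<Rightarrow> bool" where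
  "unroll_post n r L x s \<longleftrightarrow>
     imem s ''n'' 0 = n \<and> rmem s ''L'' 0 = L \<and> rmem s ''o'' 0 = 2 * real n * r \<and>
     (\<forall>j\<in>{1..2*n}. rmem s ''w'' j = unrolled n r L x j)"

lemma unroll_achieves:
  "achieves (holds_input n r L x) (Seq init_unroll (While unroll_test unroll_body))
     (ccost init_unroll + (2 * n + 1) * (1 + bcost unroll_test + ccost unroll_body))
     (unroll_post n r L x)"
proof (rule achieves_Seq)
  show "achieves (holds_input n r L x) init_unroll (ccost init_unroll)
      (\<lambda>s. unroll_inv n r L x s \<and> imem s ''i'' 0 = 1)"
    by (rule achieves_loopfree) (auto simp: init_unroll_def unroll_inv_def holds_input_def)
  show "achieves (\<lambda>s. unroll_inv n r L x s \<and> imem s ''i'' 0 = 1) (While unroll_test unroll_body)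
      ((2 * n + 1) * (1 + bcost unroll_test + ccost unroll_body)) (unroll_post n r L x)"
  proof (rule achieves_While[where I = "unroll_inv n r L x" and \<mu> = "\<lambda>s. 2 * n + 1 - imem s ''i'' 0"])
    show "loopfree unroll_body" by (simp add: unroll_body_def)
  next
    fix s assume I: "unroll_inv n r L x s" and b: "bval unroll_test s"
    define i where "i = imem s ''i'' 0"
    have i: "1 \<le> i" "i < 2 * n + 1" "imem s ''n'' 0 = n" "rmem s ''r'' 0 = r" "rmem s ''L'' 0 = L"
        "rmem s ''o'' 0 = (real i - 1) * r" "\<And>j. j \<in> {1..n} \<Longrightarrow> rmem s ''x'' j = x j"
        "\<And>j. 1 \<le> j \<Longrightarrow> j < i \<Longrightarrow> rmem s ''w'' j = unrolled n r L x j"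
      using I b by (auto simp: unroll_inv_def unroll_test_def holds_input_def i_def)
    define s' where "s' = run unroll_body s"
    define v where "v = unrolled n r L x i"
    \<comment> \<open>In either branch the cell of \<open>''x''\<close> that is read belongs to the
      input.\<close>
    have "i - n \<in> {1..n} \<or> i \<le> n" using i(1,2) by auto
    then have s': "imem s' ''i'' 0 = i + 1" "imem s' ''n'' 0 = n" "rmem s' ''r'' 0 = r"
        "rmem s' ''L'' 0 = L" "rmem s' ''o'' 0 = real i * r" "rmem s' ''x'' = rmem s ''x''"
        "rmem s' ''w'' = (rmem s ''w'')(i := v)"
      using i(1)
      by (auto simp: s'_def unroll_body_def i(3-7) i_def[symmetric] v_def unrolled_def algebra_simps)
    have "unroll_inv n r L x s'"
      unfolding unroll_inv_def holds_input_def s'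
      using i(1,2,7,8) by (auto simp: v_def less_Suc_eq)
    then show "unroll_inv n r L x (run unroll_body s) \<and>
        2 * n + 1 - imem (run unroll_body s) ''i'' 0 < 2 * n + 1 - imem s ''i'' 0"
      using i(1,2) s'(1) unfolding i_def[symmetric] s'_def by auto
  qed (auto simp: unroll_inv_def unroll_post_def unroll_test_def holds_input_def)
qed

section \<open>The pooling loop and its amortized cost\<close>

definition pool_inv :: "nat \<Rightarrow> real \<Rightarrow> (nat \<Rightarrow> real) \<Rightarrow> state \<Rightarrow> bool" where
  "pool_inv n c W s \<longleftrightarrow>
     imem s ''n'' 0 = n \<and> rmem s ''c'' 0 = c \<and> (\<forall>j\<in>{1..2*n}. rmem s ''w'' j = W j) \<and>
     block_stack n W (imem s ''f'' 0) (imem s ''k'' 0) (imem s ''st'') (rmem s ''mx'') (rmem s ''mn'')"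

definition pool_done :: "nat \<Rightarrow> real \<Rightarrow> state \<Rightarrow> bool" where
  "pool_done n c s \<longleftrightarrow>
     (let f = imem s ''f'' 0; k = imem s ''k'' 0; st = imem s ''st'';
          V = (\<lambda>p. rmem s ''mx'' p + rmem s ''mn'' p) in
       st (k + 1) = st f + n \<and> (f < k \<longrightarrow> V k \<le> V (k - 1) \<and> V f - 2 * c \<le> V k))"

text \<open>A potential: each index not yet pushed counts 2, each block on the stack 1, and the flag
  1. A push trades 2 for 1, a merge at either end removes a block, and stopping clears the
  flag.\<close>

definition pool_measure :: "state \<Rightarrow> nat" where
  "pool_measure s =
     (let f = imem s ''f'' 0; k = imem s ''k'' 0; st = imem s ''st'' in
       imem s ''go'' 0 + 2 * (st f + imem s ''n'' 0 - st (k + 1)) + (k + 1 - f))"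

lemma pool_step:
  assumes I: "pool_inv n c W s" and go: "imem s ''go'' 0 = 1" and n: "1 \<le> n"
    and per: "\<And>j. 1 \<le> j \<Longrightarrow> j \<le> n \<Longrightarrow> W (j + n) = W j - c"
  shows "pool_inv n c W (run pool_body s) \<and> pool_measure (run pool_body s) < pool_measure s \<and>
    (imem (run pool_body s) ''go'' 0 = 1 \<or>
     imem (run pool_body s) ''go'' 0 = 0 \<and> pool_done n c (run pool_body s))"
proof -
  define f k st mx mn where defs: "f = imem s ''f'' 0" "k = imem s ''k'' 0" "st = imem s ''st''"
    "mx = rmem s ''mx''" "mn = rmem s ''mn''"
  note [simp] = defs[symmetric]
  have s: "imem s ''n'' 0 = n" "rmem s ''c'' 0 = c" "\<And>j. 1 \<le> j \<Longrightarrow> j \<le> 2 * n \<Longrightarrow> rmem s ''w'' j = W j"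
    and inv: "block_stack n W f k st mx mn"
    using I by (auto simp: pool_inv_def)
  have fk1: "f \<le> k + 1" "1 \<le> st f" "st (k + 1) \<le> st f + n" using inv unfolding block_stack_def by auto
  define s' where "s' = run pool_body s"
  \<comment> \<open>These are the branches of the body; \<open>st (k + 1) \<le> st f + n\<close>
    turns the failed test for room into an equality.\<close>
  consider (merge) "f < k" "mx (k - 1) + mn (k - 1) < mx k + mn k"
    | (push) "f < k \<longrightarrow> mx k + mn k \<le> mx (k - 1) + mn (k - 1)" "st (k + 1) < st f + n"
    | (seam) "f < k \<longrightarrow> mx k + mn k \<le> mx (k - 1) + mn (k - 1)" "st (k + 1) = st f + n"
        "f < k" "mx k + mn k < mx f + mn f - 2 * c"
    | (stop) "f < k \<longrightarrow> mx k + mn k \<le> mx (k - 1) + mn (k - 1)" "st (k + 1) = st f + n"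
        "f < k \<longrightarrow> mx f + mn f - 2 * c \<le> mx k + mn k"
    using fk1 by linarith
  then have "pool_inv n c W s' \<and> pool_measure s' < pool_measure s \<and>
    (imem s' ''go'' 0 = 1 \<or> imem s' ''go'' 0 = 0 \<and> pool_done n c s')"
  proof cases
    case merge
    have step: "s' = run merge_top s" unfolding s'_def using merge by (auto simp: pool_body_def s)
    have s': "imem s' ''n'' 0 = n" "rmem s' ''c'' 0 = c" "rmem s' ''w'' = rmem s ''w''"
        "imem s' ''go'' 0 = 1" "imem s' ''f'' 0 = f" "imem s' ''k'' 0 = k - 1"
        "imem s' ''st'' = st(k := st (k + 1))"
        "rmem s' ''mx'' = mx(k - 1 := max (mx (k - 1)) (mx k))"
        "rmem s' ''mn'' = mn(k - 1 := min (mn (k - 1)) (mn k))"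
      unfolding step using merge(1) by (auto simp: merge_top_def s go)
    have "block_stack n W (f) (k - 1) (st(k := st (k + 1)))
        (mx(k - 1 := max (mx (k - 1)) (mx k))) (mn(k - 1 := min (mn (k - 1)) (mn k)))"
      using merge by (intro block_stack_merge[OF inv]) auto
    then have "pool_inv n c W s'" unfolding pool_inv_def s' using s(3) by auto
    moreover have "pool_measure s' < pool_measure s"
      unfolding pool_measure_def s' using merge fk1 by (auto simp: Let_def s go)
    ultimately show ?thesis using s'(4) by simp
  next
    case push
    have step: "s' = run push_single s" unfolding s'_def using push by (auto simp: pool_body_def s)
    \<comment> \<open>The cell of \<open>''w''\<close> read by the push has been filled by the
      unrolling.\<close>
    have top: "1 \<le> st (k + 1) \<and> st (k + 1) \<le> 2 * n"
    proof (cases "f = k + 1")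
      case False
      then have "block W (st k) (st (k + 1)) (mx k) (mn k)"
        using inv fk1 unfolding block_stack_def by auto
      then show ?thesis using push inv block_nonempty unfolding block_stack_def by fastforce
    qed (use push inv in \<open>auto simp: block_stack_def\<close>)
    have s': "imem s' ''n'' 0 = n" "rmem s' ''c'' 0 = c" "rmem s' ''w'' = rmem s ''w''"
        "imem s' ''go'' 0 = 1" "imem s' ''f'' 0 = f" "imem s' ''k'' 0 = k + 1"
        "imem s' ''st'' = st(k + 2 := st (k + 1) + 1)"
        "rmem s' ''mx'' = mx(k + 1 := W (st (k + 1)))"
        "rmem s' ''mn'' = mn(k + 1 := W (st (k + 1)))"
      unfolding step using top by (auto simp: push_single_def s go)
    have "block_stack n W (f) (k + 1) (st(k + 2 := st (k + 1) + 1))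
        (mx(k + 1 := W (st (k + 1)))) (mn(k + 1 := W (st (k + 1))))"
      using push by (intro block_stack_push[OF inv]) auto
    then have "pool_inv n c W s'" unfolding pool_inv_def s' using s(3) by auto
    moreover have "pool_measure s' < pool_measure s"
      unfolding pool_measure_def s' using push fk1 by (auto simp: Let_def s go)
    ultimately show ?thesis using s'(4) by simp
  next
    case seam
    have step: "s' = run merge_seam s" unfolding s'_def using seam by (auto simp: pool_body_def s)
    have s': "imem s' ''n'' 0 = n" "rmem s' ''c'' 0 = c" "rmem s' ''w'' = rmem s ''w''"
        "imem s' ''go'' 0 = 1" "imem s' ''f'' 0 = f + 1" "imem s' ''k'' 0 = k"
        "imem s' ''st'' = st(k + 1 := st (f + 1) + n)"
        "rmem s' ''mx'' = mx(k := max (mx k) (mx f - c))"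
        "rmem s' ''mn'' = mn(k := min (mn k) (mn f - c))"
      unfolding step using seam(3) by (auto simp: merge_seam_def s go)
    have "block_stack n W (f + 1) (k) (st(k + 1 := st (f + 1) + n))
        (mx(k := max (mx k) (mx f - c))) (mn(k := min (mn k) (mn f - c)))"
      using seam by (intro block_stack_wrap[OF inv] per) auto
    then have "pool_inv n c W s'" unfolding pool_inv_def s' using s(3) by auto
    moreover have "pool_measure s' < pool_measure s"
      unfolding pool_measure_def s' using seam fk1 by (auto simp: Let_def s go)
    ultimately show ?thesis using s'(4) by simp
  next
    case stop
    have step: "s' = run (ISet ''go'' (INum 0) (INum 0)) s" unfolding s'_def using stop by (auto simp: pool_body_def s)
    have s': "imem s' ''n'' 0 = n" "rmem s' ''c'' 0 = c" "rmem s' ''w'' = rmem s ''w''"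
        "imem s' ''go'' 0 = 0" "imem s' ''f'' 0 = f" "imem s' ''k'' 0 = k"
        "imem s' ''st'' = st"
        "rmem s' ''mx'' = mx"
        "rmem s' ''mn'' = mn"
      unfolding step using stop by (auto simp: s go)
    have "block_stack n W (f) (k) (st)
        (mx) (mn)"
      using stop by (simp add: inv)
    then have "pool_inv n c W s'" unfolding pool_inv_def s' using s(3) by auto
    moreover have "pool_measure s' < pool_measure s"
      unfolding pool_measure_def s' using stop fk1 by (auto simp: Let_def s go)
    moreover have "pool_done n c s'" unfolding pool_done_def s' Let_def using stop by auto
    ultimately show ?thesis using s'(4) by simp
  qed
  then show ?thesis unfolding s'_def .
qed

lemma pool_achieves:
  assumes n: "1 \<le> n" and c: "c = real n * r - L"
  shows "achieves (unroll_post n r L x) (Seq init_pool (While pool_test pool_body))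
     (ccost init_pool + (2 * n + 2) * (1 + bcost pool_test + ccost pool_body))
     (\<lambda>s. pool_inv n c (unrolled n r L x) s \<and> pool_done n c s)"
    (is "achieves _ _ _ ?Q")
proof (rule achieves_Seq)
  let ?W = "unrolled n r L x"
  show "achieves (unroll_post n r L x) init_pool (ccost init_pool)
      (\<lambda>s. pool_inv n c ?W s \<and> imem s ''go'' 0 = 1 \<and> pool_measure s \<le> 2 * n + 1)"
    using n c
    by (intro achieves_loopfree)
      (auto simp: init_pool_def unroll_post_def pool_inv_def pool_measure_def block_stack_def)
  \<comment> \<open>Initially the measure is \<open>2 * n + 1\<close>: the flag and \<open>n\<close>
    indices counted twice. One more round pays for the failing test.\<close>
  have eq: "(2 * n + 2) * (1 + bcost pool_test + ccost pool_body) =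
      (2 * n + 1 + 1) * (1 + bcost pool_test + ccost pool_body)" by simp
  show "achieves (\<lambda>s. pool_inv n c ?W s \<and> imem s ''go'' 0 = 1 \<and> pool_measure s \<le> 2 * n + 1)
      (While pool_test pool_body)
      ((2 * n + 2) * (1 + bcost pool_test + ccost pool_body)) ?Q"
    unfolding eq
  proof (rule achieves_While[where \<mu> = pool_measure and
        I = "\<lambda>s. pool_inv n c ?W s \<and>
          (imem s ''go'' 0 = 1 \<or> imem s ''go'' 0 = 0 \<and> pool_done n c s)"])
    show "loopfree pool_body"
      by (simp add: pool_body_def merge_top_def push_single_def merge_seam_def)
  next
    fix s
    assume "pool_inv n c ?W s \<and> (imem s ''go'' 0 = 1 \<or> imem s ''go'' 0 = 0 \<and> pool_done n c s)"
      and "bval pool_test s"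
    then show "(pool_inv n c ?W (run pool_body s) \<and> (imem (run pool_body s) ''go'' 0 = 1 \<or>
        imem (run pool_body s) ''go'' 0 = 0 \<and> pool_done n c (run pool_body s))) \<and>
        pool_measure (run pool_body s) < pool_measure s"
      using pool_step[of n c ?W s] n unrolled_shift[of _ n r L x] c by (auto simp: pool_test_def)
  qed (auto simp: pool_test_def)
qed

section \<open>The output loop\<close>

definition output_inv :: "nat \<Rightarrow> real \<Rightarrow> (nat \<Rightarrow> real) \<Rightarrow> state \<Rightarrow> bool" where
  "output_inv n c W s \<longleftrightarrow> pool_inv n c W s \<and> pool_done n c s \<and>
     (let f = imem s ''f'' 0; k = imem s ''k'' 0; st = imem s ''st''; p = imem s ''p'' 0;
          j = imem s ''j'' 0 in
       st f \<le> j \<and> j \<le> st f + n \<and>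
       (j < st f + n \<longrightarrow> p \<in> {f..k} \<and> st p \<le> j \<and> j < st (p + 1)) \<and>
       (\<forall>q\<in>{st f..<j}. \<exists>p\<in>{f..k}. st p \<le> q \<and> q < st (p + 1) \<and>
          rmem s ''delta'' (wrap n q) = (rmem s ''mx'' p + rmem s ''mn'' p) / 2 - W q))"

text \<open>With \<open>f = k + 1\<close> a full window would give \<open>st f = st f + n\<close>,
  so the stack is nonempty and the window starts at the start of a block, hence within the first
  period.\<close>

lemma pool_done_blocks:
  assumes "pool_inv n c W s" "pool_done n c s" "1 \<le> n"
  shows "imem s ''f'' 0 \<le> imem s ''k'' 0"
    and "1 \<le> imem s ''st'' (imem s ''f'' 0)" "imem s ''st'' (imem s ''f'' 0) \<le> n"
    and "\<And>p. imem s ''f'' 0 \<le> p \<Longrightarrow> p \<le> imem s ''k'' 0 \<Longrightarrow> imem s ''st'' p < imem s ''st'' (p + 1)"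
proof -
  have inv: "block_stack n W (imem s ''f'' 0) (imem s ''k'' 0) (imem s ''st'') (rmem s ''mx'') (rmem s ''mn'')"
    using assms(1) unfolding pool_inv_def by blast
  have full: "imem s ''st'' (imem s ''k'' 0 + 1) = imem s ''st'' (imem s ''f'' 0) + n"
    using assms(2) unfolding pool_done_def Let_def by blast
  show fk: "imem s ''f'' 0 \<le> imem s ''k'' 0"
    using inv full assms(3) unfolding block_stack_def
    by (metis Suc_eq_plus1 add_cancel_right_right le_SucE not_one_le_zero)
  show "1 \<le> imem s ''st'' (imem s ''f'' 0)" "imem s ''st'' (imem s ''f'' 0) \<le> n"
    using inv fk unfolding block_stack_def by auto
  show "imem s ''st'' p < imem s ''st'' (p + 1)" if "imem s ''f'' 0 \<le> p" "p \<le> imem s ''k'' 0" for p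
    using inv that block_nonempty unfolding block_stack_def by (meson atLeastAtMost_iff)
qed

lemma output_step:
  assumes I: "output_inv n c W s" and b: "bval output_test s" and n: "1 \<le> n"
  shows "output_inv n c W (run output_body s) \<and>
    imem (run output_body s) ''j'' 0 = imem s ''j'' 0 + 1 \<and>
    imem (run output_body s) ''st'' (imem (run output_body s) ''f'' 0) = imem s ''st'' (imem s ''f'' 0)"
proof -
  define f k st p j mx mn where defs: "f = imem s ''f'' 0" "k = imem s ''k'' 0" "st = imem s ''st''"
    "p = imem s ''p'' 0" "j = imem s ''j'' 0" "mx = rmem s ''mx''" "mn = rmem s ''mn''"
  note [simp] = defs[symmetric]
  define \<delta> where "\<delta> = rmem s ''delta''"
  define v where "v = (mx p + mn p) / 2 - W j"
  \<comment> \<open>For \<open>j > n\<close> the wanted cell is \<open>j - n\<close>, and cell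
    \<open>j\<close> lies beyond the range of points.\<close>
  define \<delta>' where "\<delta>' = (\<delta>(j := v))(j - n := v)"
  define p' where "p' = (if j + 1 < st (p + 1) then p else p + 1)"
  define s' where "s' = run output_body s"
  have pool: "pool_inv n c W s" "pool_done n c s" using I unfolding output_inv_def by auto
  have s: "imem s ''n'' 0 = n" "\<And>j. 1 \<le> j \<Longrightarrow> j \<le> 2 * n \<Longrightarrow> rmem s ''w'' j = W j"
    using pool by (auto simp: pool_inv_def)
  have j: "st f \<le> j" "j < st f + n"
    using I b by (auto simp: output_inv_def output_test_def s Let_def)
  then have p: "p \<in> {f..k}" "st p \<le> j" "j < st (p + 1)"
    and old: "\<forall>q\<in>{st f..<j}. \<exists>p\<in>{f..k}. st p \<le> q \<and> q < st (p + 1) \<and>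
          \<delta> (wrap n q) = (mx p + mn p) / 2 - W q"
    using I by (auto simp: output_inv_def Let_def \<delta>_def)
  note blocks = pool_done_blocks[OF pool n, simplified]
  have full: "st (k + 1) = st f + n" using pool(2) by (simp add: pool_done_def Let_def)
  have w: "rmem s ''w'' j = W j" using j blocks(2,3) by (intro s) auto
  have s': "imem s' ''n'' 0 = n" "imem s' ''f'' 0 = f" "imem s' ''k'' 0 = k" "imem s' ''st'' = st"
      "imem s' ''p'' 0 = p'" "imem s' ''j'' 0 = j + 1" "rmem s' ''mx'' = mx" "rmem s' ''mn'' = mn"
      "rmem s' ''delta'' = \<delta>'" "rmem s' ''w'' = rmem s ''w''" "rmem s' ''c'' = rmem s ''c''"
    by (auto simp: s'_def output_body_def w s p'_def \<delta>'_def v_def \<delta>_def)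
  have "pool_inv n c W s'" "pool_done n c s'"
    using pool unfolding pool_inv_def pool_done_def s' by auto
  \<comment> \<open>Claimed only inside the window: after its last index \<open>p'\<close> is
    \<open>k + 1\<close>, which is no block.\<close>
  moreover have "p' \<in> {f..k} \<and> st p' \<le> j + 1 \<and> j + 1 < st (p' + 1)" if "j + 1 < st f + n"
  proof (cases "j + 1 < st (p + 1)")
    case True
    then show ?thesis using p by (simp add: p'_def)
  next
    case False
    then have "st (p + 1) = j + 1" "p \<noteq> k" using p full that by auto
    then show ?thesis using p blocks(4)[of "p + 1"] False by (auto simp: p'_def)
  qed
  moreover have "\<exists>p\<in>{f..k}. st p \<le> q \<and> q < st (p + 1) \<and> \<delta>' (wrap n q) = (mx p + mn p) / 2 - W q"
    if "q \<in> {st f..<j + 1}" for q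
  proof (cases "q = j")
    case True
    then show ?thesis using p by (intro bexI[of _ p]) (auto simp: \<delta>'_def wrap_def v_def)
  next
    \<comment> \<open>The window has length \<open>n\<close>, so distinct indices in it denote
      distinct points and no earlier result is overwritten.\<close>
    case False
    then have "\<delta>' (wrap n q) = \<delta> (wrap n q)"
      using that j blocks(2,3) by (auto simp: \<delta>'_def wrap_def)
    then show ?thesis using old that False by auto
  qed
  ultimately show ?thesis
    using j unfolding output_inv_def Let_def s'_def[symmetric] s' by auto
qed

lemma output_achieves:
  assumes n: "1 \<le> n"
  shows "achieves (\<lambda>s. pool_inv n c W s \<and> pool_done n c s)
     (Seq init_output (While output_test output_body))
     (ccost init_output + (n + 1) * (1 + bcost output_test + ccost output_body))
     (\<lambda>s. output_inv n c W s \<and> imem s ''j'' 0 = imem s ''st'' (imem s ''f'' 0) + n)"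
    (is "achieves _ _ _ ?Q")
proof (rule achieves_Seq)
  show "achieves (\<lambda>s. pool_inv n c W s \<and> pool_done n c s) init_output (ccost init_output)
      (\<lambda>s. output_inv n c W s)"
  proof (rule achieves_loopfree)
    fix s assume s: "pool_inv n c W s \<and> pool_done n c s"
    then show "output_inv n c W (run init_output s)"
      using pool_done_blocks[of n c W s] n
      by (auto simp: init_output_def output_inv_def pool_inv_def pool_done_def Let_def)
  qed (simp add: init_output_def)
  show "achieves (\<lambda>s. output_inv n c W s) (While output_test output_body)
      ((n + 1) * (1 + bcost output_test + ccost output_body)) ?Q"
  proof (rule achieves_While[where I = "output_inv n c W" and
        \<mu> = "\<lambda>s. imem s ''st'' (imem s ''f'' 0) + n - imem s ''j'' 0"])
    fix s assume "output_inv n c W s" "bval output_test s"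
    then show "output_inv n c W (run output_body s) \<and>
        imem (run output_body s) ''st'' (imem (run output_body s) ''f'' 0) + n -
          imem (run output_body s) ''j'' 0
        < imem s ''st'' (imem s ''f'' 0) + n - imem s ''j'' 0"
      using output_step[of n c W s] n
      by (auto simp: output_test_def output_inv_def pool_inv_def Let_def)
  next
    show "output_inv n c W s \<Longrightarrow> \<not> bval output_test s \<Longrightarrow> ?Q s" for s
      by (auto simp: output_inv_def output_test_def pool_inv_def Let_def)
  qed (auto simp: output_body_def output_inv_def Let_def)
qed

section \<open>Optimality of the output and the linear time bound\<close>

lemma output_lex_optimal:
  assumes inst: "cycle_instance n r L x"
    and out: "output_inv n (real n * r - L) (unrolled n r L x) s"
    and j: "imem s ''j'' 0 = imem s ''st'' (imem s ''f'' 0) + n"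
  shows "lex_optimal n r L x (rmem s ''delta'')"
proof -
  let ?c = "real n * r - L" and ?W = "unrolled n r L x"
  have n: "1 \<le> n" and c: "0 \<le> ?c" using inst by (auto simp: cycle_instance_def)
  have pool: "pool_inv n ?c ?W s" "pool_done n ?c s" using out unfolding output_inv_def by auto
  note blocks = pool_done_blocks[OF pool n]
  have inv: "block_stack n ?W (imem s ''f'' 0) (imem s ''k'' 0) (imem s ''st'')
      (rmem s ''mx'') (rmem s ''mn'')"
    using pool(1) unfolding pool_inv_def by blast
  have "certified n ?c ?W (imem s ''st'' (imem s ''f'' 0)) (moved n r L x (rmem s ''delta''))"
  proof (rule block_stack_certified[OF inv n c])
    show "\<exists>p\<in>{imem s ''f'' 0..imem s ''k'' 0}. imem s ''st'' p \<le> q \<and> q < imem s ''st'' (p + 1) \<and>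
        moved n r L x (rmem s ''delta'') q = (rmem s ''mx'' p + rmem s ''mn'' p) / 2"
      if q: "q \<in> {imem s ''st'' (imem s ''f'' 0)..<imem s ''st'' (imem s ''f'' 0) + n}" for q
    proof -
      obtain p where "p \<in> {imem s ''f'' 0..imem s ''k'' 0}" "imem s ''st'' p \<le> q" "q < imem s ''st'' (p + 1)"
          "rmem s ''delta'' (wrap n q) = (rmem s ''mx'' p + rmem s ''mn'' p) / 2 - ?W q"
        using out q unfolding output_inv_def Let_def j by metis
      then show ?thesis by (intro bexI[of _ p]) (simp_all add: moved_def)
    qed
  qed (use pool(2) in \<open>simp_all add: pool_done_def Let_def\<close>)
  then show ?thesis by (rule certified_lex_optimal[OF inst blocks(2,3)])
qed

theorem theorem3:
  "\<exists>(c :: com) (T :: nat \<Rightarrow> nat).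
     (\<lambda>n. real (T n)) \<in> O(\<lambda>n. real n) \<and>
     (\<forall>n r L x s. cycle_instance n r L x \<longrightarrow> holds_input n r L x s \<longrightarrow>
        (\<exists>t s'. exec c s t s' \<and> t \<le> T n \<and> lex_optimal n r L x (rmem s' ''delta'')))"
proof -
  define K where "K = ccost init_unroll + ccost init_pool + ccost init_output +
    (1 + bcost unroll_test + ccost unroll_body) + (1 + bcost pool_test + ccost pool_body) +
    (1 + bcost output_test + ccost output_body)"
  define T where "T n =
    (ccost init_unroll + (2 * n + 1) * (1 + bcost unroll_test + ccost unroll_body)) +
    ((ccost init_pool + (2 * n + 2) * (1 + bcost pool_test + ccost pool_body)) +
    (ccost init_output + (n + 1) * (1 + bcost output_test + ccost output_body)))" for n
  have T_le: "T n \<le> (4 * K) * n" if "1 \<le> n" for n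
  proof -
    \<comment> \<open>\<open>K\<close> sums all cost constants and \<open>2 * n + 2\<close> is the
      largest of the three iteration bounds.\<close>
    have "T n \<le> K * (2 * n + 2)" unfolding T_def K_def by (simp add: algebra_simps)
    also have "\<dots> \<le> K * (4 * n)" using that by (intro mult_left_mono) auto
    finally show ?thesis by (simp add: mult.commute mult.left_commute)
  qed
  have "(\<lambda>n. real (T n)) \<in> O(\<lambda>n. real n)"
  proof (rule bigoI)
    show "eventually (\<lambda>n. norm (real (T n)) \<le> real (4 * K) * norm (real n)) sequentially"
      using eventually_ge_at_top[of 1]
    proof eventually_elim
      case (elim n)
      have "real (T n) \<le> real ((4 * K) * n)" using T_le[OF elim] of_nat_mono by blast
      then show ?case by simp
    qed
  qed
  moreover have "\<exists>t s'. exec algorithm s t s' \<and> t \<le> T n \<and> lex_optimal n r L x (rmem s' ''delta'')"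
    if inst: "cycle_instance n r L x" and input: "holds_input n r L x s" for n r L x s
  proof -
    have n: "1 \<le> n" using inst by (simp add: cycle_instance_def)
    have "achieves (holds_input n r L x) algorithm (T n)
        (\<lambda>s. output_inv n (real n * r - L) (unrolled n r L x) s \<and>
          imem s ''j'' 0 = imem s ''st'' (imem s ''f'' 0) + n)"
      unfolding algorithm_def T_def
      by (rule achieves_Seq[OF unroll_achieves
            achieves_Seq[OF pool_achieves[OF n refl] output_achieves[OF n]]])
    then obtain t s' where "exec algorithm s t s'" "t \<le> T n"
        "output_inv n (real n * r - L) (unrolled n r L x) s'"
        "imem s' ''j'' 0 = imem s' ''st'' (imem s' ''f'' 0) + n"
      using input unfolding achieves_def by blast
    then show ?thesis using output_lex_optimal[OF inst] by blast
  qed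
  ultimately show ?thesis by blast
qed

end
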